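(* Let $D$ be a diagram of an ordered (classical or virtual) tangle $T$. Then $\nabla(D)$ depends only on the ordered tangle $T$, i.e. $\nabla(T):=\nabla(D)$ is an invariant of ordered (classical or virtual) tangles.
   Context: An $n$-tangle ($n\ge 1$) is a collection of $n$ disjoint oriented intervals ("strings") and finitely many oriented circles ("closed components") properly embedded in the 3-ball with string endpoints at $2n$ prescribed boundary points, represented by diagrams; virtual tangle diagrams may also contain virtual crossings (no over/under information), and virtual tangles are diagrams modulo classical and virtual Reidemeister moves (classical tangles: modulo classical Reidemeister moves), performed away from the boundary. For a string, its source is its input and its target its output. A tangle with $n$ strings is ordered if its $2n$ endpoints are numbered by integers $j_1<\dots<j_{2n}$ (up to monotone relabeling) so that every input receives some $j_{2k-1}$ and every output some $j_{2k}$; the ordering is coherent if for each $k$ the string with input $j_{2k-1}$ has output $j_{2k}$. For an ordered tangle diagram $D$: a state $S$ is a set of classical crossings; $D(S)$ is obtained by smoothing each crossing of $S$ respecting orientations and inherits the endpoint numbering. $S$ is coherent if $D(S)$ has no closed components and its ordering is coherent. For coherent $S$, traverse $D(S)$ along the string from $j_1$ to $j_2$, then the string from $j_3$ to $j_4$, etc.; the neighborhood of each smoothed crossing is passed twice, and $S$ is descending if for each crossing of $S$ its neighborhood is first entered along the former overpass. $\operatorname{sign}(S)$ is the product of local writhes of the crossings of $S$. Define $c_n(D)=\sum\operatorname{sign}(S)$ over descending states with $n$ crossings and $\nabla(D)=\sum_{n\ge0}c_n(D)z^n\in\mathbb Z[z]$. *)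

theory Defs
  imports Main "HOL-Computational_Algebra.Polynomial"
begin

text \<open>A point of a diagram is either an end of a classical crossing
  (X c True = the overpass end of crossing c, X c False = its underpass end)
  or a boundary point Bd l.  The 2n boundary points are numbered 0..2n-1;
  even numbers are inputs (sources of strings), odd numbers are outputs
  (this is the normalised form of an ordering j_1 < ... < j_2n).
  nxt p is the next point reached when travelling from p along the
  orientation.  Closed components without classical crossings are counted
  by free.  Virtual crossings carry no information and are not recorded.\<close>

datatype pt = X nat bool | Bd nat

record gd =
  nstr :: nat
  crs  :: "nat set"
  nxt  :: "pt \<Rightarrow> pt"
  wr   :: "nat \<Rightarrow> int"
  free :: nat

definition ends :: "nat set \<Rightarrow> pt set" where
  "ends C = {X c ov | c ov. c \<in> C}"

definition srcs :: "gd \<Rightarrow> pt set" where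
  "srcs G = ends (crs G) \<union> {Bd l | l. l < 2 * nstr G \<and> even l}"

definition tgts :: "gd \<Rightarrow> pt set" where
  "tgts G = ends (crs G) \<union> {Bd l | l. l < 2 * nstr G \<and> odd l}"

definition wf_gd :: "gd \<Rightarrow> bool" where
  "wf_gd G \<longleftrightarrow> nstr G \<ge> 1 \<and> finite (crs G) \<and> bij_betw (nxt G) (srcs G) (tgts G)
     \<and> (\<forall>c\<in>crs G. wr G c = 1 \<or> wr G c = -1)"

text \<open>Travelling in D(S): arriving at an end of a smoothed crossing c \<in> S one
  continues along the outgoing arc of the other end of c (oriented smoothing).
  Outputs are terminal.\<close>

definition sstep :: "gd \<Rightarrow> nat set \<Rightarrow> pt \<Rightarrow> pt" where
  "sstep G S p = (case p of
      X c ov \<Rightarrow> (if c \<in> S then nxt G (X c (\<not> ov)) else nxt G p)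
    | Bd l \<Rightarrow> (if even l then nxt G p else p))"

definition walk :: "gd \<Rightarrow> nat set \<Rightarrow> nat \<Rightarrow> nat \<Rightarrow> pt" where
  "walk G S k i = (sstep G S ^^ i) (Bd (2 * k))"

definition visits :: "gd \<Rightarrow> nat set \<Rightarrow> nat \<Rightarrow> pt \<Rightarrow> bool" where
  "visits G S k p \<longleftrightarrow> (\<exists>i. walk G S k i = p)"

text \<open>Coherent: D(S) has no closed components (no free circles, every
  crossing end lies on a string) and the string starting at input 2k ends
  at output 2k+1.\<close>

definition coherent :: "gd \<Rightarrow> nat set \<Rightarrow> bool" where
  "coherent G S \<longleftrightarrow> S \<subseteq> crs G \<and> free G = 0
     \<and> (\<forall>k<nstr G. visits G S k (Bd (2 * k + 1)))
     \<and> (\<forall>p\<in>ends (crs G). \<exists>k<nstr G. visits G S k p)"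

text \<open>Descending: traversing the strings in the order 0,1,...,n-1, the
  neighbourhood of every smoothed crossing is first entered along the former
  overpass, i.e. its overpass end is reached before its underpass end.\<close>

definition descending :: "gd \<Rightarrow> nat set \<Rightarrow> bool" where
  "descending G S \<longleftrightarrow> coherent G S \<and>
     (\<forall>c\<in>S. \<exists>k i k' i'. k < nstr G \<and> k' < nstr G
        \<and> walk G S k i = X c True \<and> walk G S k' i' = X c False
        \<and> (k < k' \<or> (k = k' \<and> i < i')))"

definition ssign :: "gd \<Rightarrow> nat set \<Rightarrow> int" where
  "ssign G S = (\<Prod>c\<in>S. wr G c)"

definition coef :: "gd \<Rightarrow> nat \<Rightarrow> int" where
  "coef G m = (\<Sum>S | S \<subseteq> crs G \<and> card S = m \<and> descending G S. ssign G S)"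

definition conway :: "gd \<Rightarrow> int poly" where
  "conway G = (\<Sum>m\<le>card (crs G). monom (coef G m) m)"

fun mp :: "(nat \<Rightarrow> nat) \<Rightarrow> pt \<Rightarrow> pt" where
  "mp f (X c ov) = X (f c) ov"
| "mp f (Bd l) = Bd l"

definition iso :: "gd \<Rightarrow> gd \<Rightarrow> bool" where
  "iso G G' \<longleftrightarrow> nstr G' = nstr G \<and> free G' = free G \<and>
     (\<exists>f. inj_on f (crs G) \<and> crs G' = f ` crs G
        \<and> (\<forall>p\<in>srcs G. nxt G' (mp f p) = mp f (nxt G p))
        \<and> (\<forall>c\<in>crs G. wr G' (f c) = wr G c))"

text \<open>Insertion of words of new crossing ends into edges.  An edge is named by
  its source point a (the edge a \<rightarrow> nxt a).  Several words inserted into the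
  same edge are placed consecutively, in the order of the list.\<close>

definition chain :: "(pt \<times> pt list) list \<Rightarrow> pt \<Rightarrow> pt list" where
  "chain ws a = concat (map snd (filter (\<lambda>x. fst x = a) ws))"

definition ins_nxt :: "(pt \<Rightarrow> pt) \<Rightarrow> (pt \<times> pt list) list \<Rightarrow> pt \<Rightarrow> pt" where
  "ins_nxt nx ws p = (case chain ws p of
      q # _ \<Rightarrow> q
    | [] \<Rightarrow> (if \<exists>a i. i < length (chain ws a) \<and> chain ws a ! i = p
            then (THE q. \<exists>a i. i < length (chain ws a) \<and> chain ws a ! i = p
                              \<and> q = (chain ws a @ [nx a]) ! Suc i)
            else nx p))"

definition insert_gd :: "gd \<Rightarrow> nat set \<Rightarrow> (nat \<Rightarrow> int) \<Rightarrow> (pt \<times> pt list) list \<Rightarrow> gd" where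
  "insert_gd G C e ws = G\<lparr>crs := crs G \<union> C, nxt := ins_nxt (nxt G) ws,
                          wr := (\<lambda>c. if c \<in> C then e c else wr G c)\<rparr>"

definition ins_ok :: "gd \<Rightarrow> nat set \<Rightarrow> (nat \<Rightarrow> int) \<Rightarrow> (pt \<times> pt list) list \<Rightarrow> bool" where
  "ins_ok G C e ws \<longleftrightarrow> finite C \<and> C \<inter> crs G = {} \<and> (\<forall>x\<in>set ws. fst x \<in> srcs G)
     \<and> distinct (concat (map snd ws)) \<and> set (concat (map snd ws)) = ends C
     \<and> (\<forall>c\<in>C. e c = 1 \<or> e c = -1)"

definition R1 :: "gd \<Rightarrow> gd \<Rightarrow> bool" where
  "R1 G G' \<longleftrightarrow> (\<exists>a c ov e. ins_ok G {c} e [(a, [X c ov, X c (\<not> ov)])]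
      \<and> G' = insert_gd G {c} e [(a, [X c ov, X c (\<not> ov)])])"

definition R1free :: "gd \<Rightarrow> gd \<Rightarrow> bool" where
  "R1free G G' \<longleftrightarrow> (\<exists>m c ov e. free G = Suc m \<and> c \<notin> crs G \<and> (e = 1 \<or> e = -1)
      \<and> G' = G\<lparr>free := m, crs := crs G \<union> {c},
                nxt := (nxt G)(X c ov := X c (\<not> ov), X c (\<not> ov) := X c ov),
                wr := (wr G)(c := e)\<rparr>)"

text \<open>R2: one strand passes over another one twice; crossings of opposite
  signs; the second strand meets them in the same order (parallel strands)
  or in the reverse order (antiparallel strands).\<close>

definition R2 :: "gd \<Rightarrow> gd \<Rightarrow> bool" where
  "R2 G G' \<longleftrightarrow> (\<exists>a1 a2 c1 c2 ov \<epsilon> r sw.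
      let s1 = (a1, [X c1 ov, X c2 ov]);
          s2 = (a2, if r then [X c2 (\<not> ov), X c1 (\<not> ov)] else [X c1 (\<not> ov), X c2 (\<not> ov)]);
          ws = (if sw then [s2, s1] else [s1, s2]);
          e = (\<lambda>c. if c = c1 then \<epsilon> else - \<epsilon>)
      in c1 \<noteq> c2 \<and> ins_ok G {c1, c2} e ws \<and> G' = insert_gd G {c1, c2} e ws)"

text \<open>R3: strands 0 (top), 1 (middle), 2 (bottom); crossing c01 (0 over 1),
  c02 (0 over 2), c12 (1 over 2).  b0: on strand 0, c01 comes before c02;
  b1: on strand 1, c01 before c12; b2: on strand 2, c02 before c12.
  The configurations occurring for three straight oriented lines are exactly
  those satisfying r3_ok (computed from the planar geometry); the move
  reverses the order of the two crossings on each strand, keeping signs.\<close>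

definition r3_ok :: "bool \<Rightarrow> bool \<Rightarrow> bool \<Rightarrow> int \<Rightarrow> int \<Rightarrow> int \<Rightarrow> bool" where
  "r3_ok b0 b1 b2 e01 e02 e12 \<longleftrightarrow> ((e01 = e02) = (b1 = b2)) \<and> ((e02 = e12) = (b0 = b1))"

definition R3 :: "gd \<Rightarrow> gd \<Rightarrow> bool" where
  "R3 G G' \<longleftrightarrow> (\<exists>G0 a0 a1 a2 c01 c02 c12 b0 b1 b2 e01 e02 e12 ws.
      let w0 = (if b0 then [X c01 True, X c02 True] else [X c02 True, X c01 True]);
          w1 = (if b1 then [X c01 False, X c12 True] else [X c12 True, X c01 False]);
          w2 = (if b2 then [X c02 False, X c12 False] else [X c12 False, X c02 False]);
          C = {c01, c02, c12};
          e = (\<lambda>c. if c = c01 then e01 else if c = c02 then e02 else e12)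
      in wf_gd G0 \<and> distinct [c01, c02, c12] \<and> r3_ok b0 b1 b2 e01 e02 e12
        \<and> length ws = 3 \<and> set ws = {(a0, w0), (a1, w1), (a2, w2)}
        \<and> ins_ok G0 C e ws
        \<and> G = insert_gd G0 C e ws
        \<and> G' = insert_gd G0 C e (map (\<lambda>x. (fst x, rev (snd x))) ws))"

definition move :: "gd \<Rightarrow> gd \<Rightarrow> bool" where
  "move G G' \<longleftrightarrow> iso G G' \<or> R1 G G' \<or> R1free G G' \<or> R2 G G' \<or> R3 G G'"

definition tangle_equiv :: "gd \<Rightarrow> gd \<Rightarrow> bool" where
  "tangle_equiv = equivclp (\<lambda>G G'. wf_gd G \<and> wf_gd G' \<and> move G G')"

end

theory Submission
  imports Defs
begin

text \<open>Every Reidemeister move replaces words of crossing ends inserted at fixed places ("slots") of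
  a common base diagram.  Split a state into its part \<open>S\<close> outside and its part \<open>T\<close> inside the moved
  region.  The smoothing \<open>T\<close> influences the outside only through the permutation \<open>\<pi>\<close> that says where
  a string entering a slot leaves again, and the outside influences whether \<open>T\<close> is descending only
  through the order \<open>\<sigma>\<close> in which the slots are entered.  Hence \<open>conway\<close> is a sum, over \<open>S\<close> and over
  the admissible \<open>(\<pi>, \<sigma>)\<close>, of an outer term times a local weight depending on \<open>\<pi>\<close> and \<open>\<sigma>\<close> only,
  and invariance under a move reduces to the equality of local weights, a finite computation.\<close>

subsection \<open>Traces of strings\<close>

text \<open>Empty words shape the argument. The first and second moves remove crossings altogether,
  so passing a slot may leave no mark in the actual diagram, and several slots may share an edge.
  Making the slots points of an auxiliary diagram keeps such passages visible; the actual traversal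
  then follows the auxiliary one in steps of variable, possibly zero, length. Which pairs
  \<open>(\<pi>, \<sigma>)\<close> a given outside realises is never determined: local weights are
  compared for all of them. Only the identity permutation needs care, because the state of an empty
  word counts 1 even if its slot is missed, whereas crossings in the slot would then be missed too.
  Traversals end and do not meet since the traversal map is injective on the relevant points and no
  input has a preimage. The only move that is not an insertion into edges is the kink on a
  crossingless circle, where both polynomials vanish.\<close>

fun before :: "'a \<Rightarrow> 'a \<Rightarrow> 'a list \<Rightarrow> bool" where
  "before x y [] \<longleftrightarrow> False"
| "before x y (z # zs) \<longleftrightarrow> (x = z \<and> y \<in> set zs) \<or> before x y zs"

lemma before_append:
  "before x y (xs @ ys) \<longleftrightarrow> before x y xs \<or> before x y ys \<or> (x \<in> set xs \<and> y \<in> set ys)"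
  by (induction xs) auto

lemma before_filter: "P x \<Longrightarrow> P y \<Longrightarrow> before x y (filter P xs) \<longleftrightarrow> before x y xs"
  by (induction xs) auto

lemma before_map:
  "inj_on f (insert x (insert y (set xs))) \<Longrightarrow> before (f x) (f y) (map f xs) \<longleftrightarrow> before x y xs"
proof (induction xs)
  case (Cons z zs)
  have "inj_on f (insert x (insert y (set zs)))"
    by (rule inj_on_subset[OF Cons.prems]) auto
  moreover have "f x = f z \<longleftrightarrow> x = z"
    using Cons.prems by (auto simp: inj_on_def)
  moreover have "f y \<in> f ` set zs \<longleftrightarrow> y \<in> set zs"
    using Cons.prems by (auto simp: inj_on_def)
  ultimately show ?case using Cons.IH by simp
qed simp

lemma before_nth:
  "before x y xs \<longleftrightarrow> (\<exists>i j. i < j \<and> j < length xs \<and> xs ! i = x \<and> xs ! j = y)"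
proof (induction xs)
  case (Cons z zs)
  show ?case (is "?L = ?R")
  proof
    assume ?L
    then consider "x = z" "y \<in> set zs" | "before x y zs" by auto
    then show ?R
    proof cases
      case 1
      then obtain j where "j < length zs" "zs ! j = y" by (auto simp: in_set_conv_nth)
      with 1 show ?thesis by (intro exI[of _ 0] exI[of _ "Suc j"]) auto
    next
      case 2
      with Cons.IH obtain i j where "i < j" "j < length zs" "zs ! i = x" "zs ! j = y" by auto
      then show ?thesis by (intro exI[of _ "Suc i"] exI[of _ "Suc j"]) auto
    qed
  next
    assume ?R
    then obtain i j where ij: "i < j" "j < length (z # zs)" "(z # zs) ! i = x" "(z # zs) ! j = y"
      by blast
    then obtain j' where j': "j = Suc j'" by (cases j) auto
    show ?L
    proof (cases i)
      case 0
      with ij j' show ?thesis by auto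
    next
      case (Suc i')
      with ij j' Cons.IH show ?thesis by auto
    qed
  qed
qed simp

text \<open>The right-hand side has the shape of the condition in \<open>descending\<close>, with a
  string index and a time for each passage; the left-hand side sees only one list, the concatenated
  trace.\<close>

lemma before_concat:
  "before x y (concat V) \<longleftrightarrow>
    (\<exists>k i k' i'. k < length V \<and> k' < length V \<and> i < length (V ! k) \<and> i' < length (V ! k')
      \<and> V ! k ! i = x \<and> V ! k' ! i' = y \<and> (k < k' \<or> (k = k' \<and> i < i')))"
proof (induction V)
  case (Cons v V)
  show ?case (is "?L = ?R")
  proof
    assume ?L
    then consider "before x y v" | "before x y (concat V)" | "x \<in> set v" "y \<in> set (concat V)"
      by (auto simp: before_append)
    then show ?R
    proof cases
      case 1
      then obtain i j where "i < j" "j < length v" "v ! i = x" "v ! j = y"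
        unfolding before_nth by blast
      then show ?thesis
        by (intro exI[of _ 0] exI[of _ i] exI[of _ j] exI[of _ "0::nat"]) auto
    next
      case 2
      then obtain k i k' i' where "k < length V \<and> k' < length V \<and> i < length (V ! k) \<and> i' < length (V ! k')
      \<and> V ! k ! i = x \<and> V ! k' ! i' = y \<and> (k < k' \<or> (k = k' \<and> i < i'))" 
        using Cons.IH by blast
      then show ?thesis
        by (intro exI[of _ "Suc k"] exI[of _ i] exI[of _ "Suc k'"] exI[of _ i']) auto
    next
      case 3
      then obtain i where i: "i < length v" "v ! i = x" by (auto simp: in_set_conv_nth)
      from 3 obtain w where "w \<in> set V" "y \<in> set w" by auto
      then obtain k' i' where "k' < length V" "i' < length (V ! k')" "V ! k' ! i' = y"
        by (metis in_set_conv_nth)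
      with i show ?thesis
        by (intro exI[of _ 0] exI[of _ i] exI[of _ "Suc k'"] exI[of _ i']) auto
    qed
  next
    assume ?R
    then obtain k i k' i' where *: "k < length (v # V)" "k' < length (v # V)"
      "i < length ((v # V) ! k)" "i' < length ((v # V) ! k')"
      "(v # V) ! k ! i = x" "(v # V) ! k' ! i' = y" "k < k' \<or> (k = k' \<and> i < i')" by blast
    show ?L
    proof (cases k)
      case 0
      show ?thesis
      proof (cases k')
        case 0
        with \<open>k = 0\<close> * have "before x y v" by (auto simp: before_nth)
        then show ?thesis by (simp add: before_append)
      next
        case (Suc j)
        with 0 * have "x \<in> set v" "V ! j \<in> set V" "y \<in> set (V ! j)" by auto
        then show ?thesis by (auto simp: before_append)
      qed
    next
      case (Suc l)
      with * obtain j where j: "k' = Suc j" by (cases k') auto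
      have "before x y (concat V)"
        unfolding Cons.IH using * Suc j
        by (intro exI[of _ l] exI[of _ i] exI[of _ j] exI[of _ i']) auto
      then show ?thesis by (simp add: before_append)
    qed
  qed
qed simp

text \<open>The endpoint is not listed, so consecutive segments concatenate without repeating a
  point.\<close>

fun path :: "('a \<Rightarrow> 'a) \<Rightarrow> 'a \<Rightarrow> 'a list \<Rightarrow> 'a \<Rightarrow> bool" where
  "path f x [] y \<longleftrightarrow> x = y"
| "path f x (z # zs) y \<longleftrightarrow> z = x \<and> path f (f x) zs y"

lemma path_append: "path f x (xs @ ys) z \<longleftrightarrow> (\<exists>y. path f x xs y \<and> path f y ys z)"
  by (induction xs arbitrary: x) auto

lemma path_funpow: "path f x (map (\<lambda>i. (f ^^ i) x) [0..<n]) ((f ^^ n) x)"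
  by (induction n) (auto simp: path_append)

lemma path_iff:
  "path f x xs y \<longleftrightarrow> xs = map (\<lambda>i. (f ^^ i) x) [0..<length xs] \<and> y = (f ^^ length xs) x"
proof
  assume "path f x xs y"
  then show "xs = map (\<lambda>i. (f ^^ i) x) [0..<length xs] \<and> y = (f ^^ length xs) x"
  proof (induction xs arbitrary: x)
    case (Cons z zs)
    then have "z = x" and IH: "zs = map (\<lambda>i. (f ^^ i) (f x)) [0..<length zs]" "y = (f ^^ length zs) (f x)"
      by auto
    have "map (\<lambda>i. (f ^^ i) x) [0..<length (z # zs)] = x # map (\<lambda>i. (f ^^ i) (f x)) [0..<length zs]"
      by (simp add: map_upt_Suc funpow_swap1 del: upt_Suc)
    with \<open>z = x\<close> IH show ?case by (simp add: funpow_swap1)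
  qed simp
qed (metis path_funpow)

lemma path_fixpoint: "f x = x \<Longrightarrow> path f x xs y \<Longrightarrow> y = x \<and> set xs \<subseteq> {x}"
  by (induction xs) auto

text \<open>The endpoints are fixed points absent from the lists, so both lists stop at the first
  arrival at a fixed point; a longer list would have to contain the endpoint of the shorter
  one.\<close>

lemma path_unique:
  assumes "path f x xs y" "path f x ys z" "f y = y" "f z = z" "y \<notin> set xs" "z \<notin> set ys"
  shows "xs = ys \<and> y = z"
  using assms
proof (induction xs arbitrary: x ys)
  case Nil
  then show ?case by (cases ys) (auto dest: path_fixpoint)
next
  case (Cons u us)
  then show ?case by (cases ys) (auto dest: path_fixpoint)
qed

text \<open>Outputs are fixed by the traversal, so a trace could be prolonged at will; excluding the
  output from the list cuts it at the first arrival and makes it unique. Existence of a trace says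
  that every string ends at its coherent output.\<close>

definition tracing :: "(pt \<Rightarrow> pt) \<Rightarrow> nat \<Rightarrow> pt list list \<Rightarrow> bool" where
  "tracing f n V \<longleftrightarrow> length V = n \<and>
    (\<forall>k<n. path f (Bd (2 * k)) (V ! k) (Bd (2 * k + 1)) \<and> Bd (2 * k + 1) \<notin> set (V ! k))"

lemma tracing_unique:
  assumes "tracing f n V" "tracing f n V'" "\<And>k. k < n \<Longrightarrow> f (Bd (2 * k + 1)) = Bd (2 * k + 1)"
  shows "V = V'"
proof (rule nth_equalityI)
  show "length V = length V'" using assms by (simp add: tracing_def)
  fix k assume "k < length V"
  then have "k < n" using assms by (simp add: tracing_def)
  with assms show "V ! k = V' ! k"
    unfolding tracing_def using path_unique by metis
qed

lemma sstep_odd: "odd l \<Longrightarrow> sstep G S (Bd l) = Bd l"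
  by (simp add: sstep_def)

lemma funpow_fixpoint: "f x = x \<Longrightarrow> (f ^^ n) x = x"
  by (induction n) auto

lemma walk_tracing:
  assumes "tracing (sstep G S) (nstr G) V" "k < nstr G"
  shows "walk G S k i = (if i < length (V ! k) then V ! k ! i else Bd (2 * k + 1))"
proof -
  from assms have p: "V ! k = map (walk G S k) [0..<length (V ! k)]"
    and e: "walk G S k (length (V ! k)) = Bd (2 * k + 1)"
    unfolding tracing_def path_iff walk_def by auto
  show ?thesis
  proof (cases "i < length (V ! k)")
    case True
    then have "V ! k ! i = walk G S k i" by (subst p) simp
    with True show ?thesis by simp
  next
    case False
    then obtain j where "i = j + length (V ! k)" by (metis add.commute le_Suc_ex not_less)
    then have "walk G S k i = (sstep G S ^^ j) (Bd (2 * k + 1))"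
      using e by (simp add: walk_def funpow_add)
    with False show ?thesis by (simp add: funpow_fixpoint sstep_odd)
  qed
qed

lemma coherent_tracing:
  assumes "coherent G S"
  obtains V where "tracing (sstep G S) (nstr G) V"
proof -
  \<comment> \<open>The first arrival time, as \<open>tracing\<close> forbids the output inside the
    list.\<close>
  define len where "len k = (LEAST i. walk G S k i = Bd (2 * k + 1))" for k
  define V where "V = map (\<lambda>k. map (walk G S k) [0..<len k]) [0..<nstr G]"
  have "tracing (sstep G S) (nstr G) V"
    unfolding tracing_def
  proof (intro conjI allI impI)
    fix k assume k: "k < nstr G"
    with assms have "\<exists>i. walk G S k i = Bd (2 * k + 1)" by (simp add: coherent_def visits_def)
    then have e: "walk G S k (len k) = Bd (2 * k + 1)" unfolding len_def by (rule LeastI_ex)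
    have "walk G S k i \<noteq> Bd (2 * k + 1)" if "i < len k" for i
      using that unfolding len_def by (rule not_less_Least)
    with k show "Bd (2 * k + 1) \<notin> set (V ! k)"
      by (simp add: V_def image_iff) (metis atLeastLessThan_iff)
    have "V ! k = map (\<lambda>i. (sstep G S ^^ i) (Bd (2 * k))) [0..<len k]"
      using k by (simp add: V_def walk_def)
    with e show "path (sstep G S) (Bd (2 * k)) (V ! k) (Bd (2 * k + 1))"
      using path_funpow by (metis walk_def)
  qed (simp add: V_def)
  then show thesis by (rule that)
qed

text \<open>Coherence splits into the existence of the trace (strings end where they should) and the
  covering of all crossing ends (no closed component with crossings). Everything else is read off
  the single list \<open>concat V\<close>.\<close>

lemma descending_iff:
  "descending G S \<longleftrightarrow> S \<subseteq> crs G \<and> free G = 0 \<and>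
    (\<exists>V. tracing (sstep G S) (nstr G) V \<and> ends (crs G) \<subseteq> set (concat V)
      \<and> (\<forall>c\<in>S. before (X c True) (X c False) (concat V)))"
proof -
  have vis: "(\<exists>k<nstr G. visits G S k p) \<longleftrightarrow> p \<in> set (concat V)"
    if "tracing (sstep G S) (nstr G) V" "p \<in> ends C" for V p C
  proof
    assume "\<exists>k<nstr G. visits G S k p"
    then obtain k i where k: "k < nstr G" "walk G S k i = p" by (auto simp: visits_def)
    with walk_tracing[OF that(1) k(1)] that(2) have "p \<in> set (V ! k)"
      by (auto simp: ends_def split: if_splits) (metis nth_mem)
    moreover from k that have "V ! k \<in> set V" by (simp add: tracing_def)
    ultimately show "p \<in> set (concat V)" by auto
  next
    assume "p \<in> set (concat V)"
    then obtain k i where k: "k < length V" "i < length (V ! k)" "V ! k ! i = p"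
      by (auto simp: in_set_conv_nth)
    with that have "k < nstr G" by (simp add: tracing_def)
    with k walk_tracing[OF that(1), of k i] show "\<exists>k<nstr G. visits G S k p"
      by (auto simp: visits_def)
  qed
  have bef: "(\<exists>k i k' i'. k < nstr G \<and> k' < nstr G
        \<and> walk G S k i = X c True \<and> walk G S k' i' = X c False
        \<and> (k < k' \<or> (k = k' \<and> i < i'))) \<longleftrightarrow> before (X c True) (X c False) (concat V)"
    if "tracing (sstep G S) (nstr G) V" for V c
  proof -
    have w: "walk G S k i = X c ov \<longleftrightarrow> i < length (V ! k) \<and> V ! k ! i = X c ov"
      if "k < nstr G" for k i ov
      using walk_tracing[OF \<open>tracing _ _ _\<close> that] by auto
    have l: "length V = nstr G" using that by (simp add: tracing_def)
    show ?thesis unfolding before_concat l using w by blast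
  qed
  have str: "visits G S k (Bd (2 * k + 1))" if "tracing (sstep G S) (nstr G) V" "k < nstr G" for V k
    unfolding visits_def using walk_tracing[OF that, of "length (V ! k)"] by auto
  show ?thesis
  proof
    assume d: "descending G S"
    then obtain V where V: "tracing (sstep G S) (nstr G) V"
      using coherent_tracing by (auto simp: descending_def)
    from d have "S \<subseteq> crs G" "free G = 0" by (auto simp: descending_def coherent_def)
    moreover have "ends (crs G) \<subseteq> set (concat V)"
      using d vis[OF V] by (auto simp: descending_def coherent_def)
    moreover have "\<forall>c\<in>S. before (X c True) (X c False) (concat V)"
      using d bef[OF V] by (auto simp: descending_def)
    ultimately show "S \<subseteq> crs G \<and> free G = 0 \<and>
      (\<exists>V. tracing (sstep G S) (nstr G) V \<and> ends (crs G) \<subseteq> set (concat V)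
      \<and> (\<forall>c\<in>S. before (X c True) (X c False) (concat V)))" using V by blast
  next
    assume "S \<subseteq> crs G \<and> free G = 0 \<and>
      (\<exists>V. tracing (sstep G S) (nstr G) V \<and> ends (crs G) \<subseteq> set (concat V)
      \<and> (\<forall>c\<in>S. before (X c True) (X c False) (concat V)))"
    then obtain V where *: "S \<subseteq> crs G" "free G = 0" and V: "tracing (sstep G S) (nstr G) V"
      "ends (crs G) \<subseteq> set (concat V)" "\<forall>c\<in>S. before (X c True) (X c False) (concat V)" by blast
    then show "descending G S"
      unfolding descending_def coherent_def using vis[OF V(1)] bef[OF V(1)] str[OF V(1)] by blast
  qed
qed

section \<open>The polynomial as one sum over all states\<close>

lemma sum_monom: "(\<Sum>x\<in>A. monom (f x) m) = monom (\<Sum>x\<in>A. f x) m"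
  by (induction A rule: infinite_finite_induct) (auto simp: add_monom)

text \<open>Undoes the grouping by the number of crossings, so that a state can be split into
  disjoint parts outside and inside the moved region.\<close>

lemma conway_eq_sum:
  assumes "finite (crs G)"
  shows "conway G = (\<Sum>S\<in>Pow (crs G). if descending G S then monom (ssign G S) (card S) else 0)"
proof -
  have "conway G = (\<Sum>m\<le>card (crs G). \<Sum>S\<in>{S \<in> Pow (crs G). card S = m}.
      if descending G S then monom (ssign G S) (card S) else 0)"
    unfolding conway_def coef_def
  proof (rule sum.cong[OF refl])
    fix m
    let ?A = "{S \<in> Pow (crs G). card S = m}"
    have fin: "finite ?A" using assms by simp
    have "(\<Sum>S\<in>?A. if descending G S then monom (ssign G S) (card S) else 0)
        = (\<Sum>S\<in>?A \<inter> {S. descending G S}. monom (ssign G S) (card S))"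
      using fin by (subst sum.inter_restrict) (auto intro!: sum.cong)
    also have "?A \<inter> {S. descending G S} = {S. S \<subseteq> crs G \<and> card S = m \<and> descending G S}" by auto
    also have "(\<Sum>S | S \<subseteq> crs G \<and> card S = m \<and> descending G S. monom (ssign G S) (card S))
       = monom (\<Sum>S | S \<subseteq> crs G \<and> card S = m \<and> descending G S. ssign G S) m"
      by (subst sum_monom[symmetric]) (auto intro: sum.cong)
    finally show "monom (\<Sum>S | S \<subseteq> crs G \<and> card S = m \<and> descending G S. ssign G S) m =
      (\<Sum>S\<in>?A. if descending G S then monom (ssign G S) (card S) else 0)" by simp
  qed
  also have "\<dots> = (\<Sum>S\<in>Pow (crs G). if descending G S then monom (ssign G S) (card S) else 0)"
    using assms by (intro sum.group) (auto intro: card_mono)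
  finally show ?thesis .
qed

subsection \<open>Inserting words into edges\<close>

lemma set_chain: "set (chain ws a) = \<Union> (set ` snd ` {x \<in> set ws. fst x = a})"
  by (auto simp: chain_def)

lemma set_chain_subset: "set (chain ws a) \<subseteq> set (concat (map snd ws))"
  by (auto simp: chain_def)

lemma distinct_chain: "distinct (concat (map snd ws)) \<Longrightarrow> distinct (chain ws a)"
proof (induction ws)
  case (Cons w ws)
  then show ?case using set_chain_subset[of ws a] by (auto simp: chain_def)
qed (simp add: chain_def)

lemma chain_inject:
  assumes "distinct (concat (map snd ws))" "p \<in> set (chain ws a)" "p \<in> set (chain ws b)"
  shows "a = b"
  using assms
proof (induction ws)
  case (Cons w ws)
  have "chain (w # ws) c = (if fst w = c then snd w else []) @ chain ws c" for c
    by (simp add: chain_def)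
  with Cons show ?case
    using set_chain_subset[of ws a] set_chain_subset[of ws b] by (auto split: if_splits)
qed (simp add: chain_def)

text \<open>\<open>last (a # us)\<close> is the predecessor of \<open>y\<close> on the subdivided edge \<open>a\<close>, \<open>chain ws a\<close>, \<open>nx a\<close>.\<close>

lemma ins_nxt_successor:
  assumes dist: "distinct (concat (map snd ws))"
    and anch: "fst ` set ws \<inter> set (concat (map snd ws)) = {}"
    and a: "a \<notin> set (concat (map snd ws))"
    and split: "chain ws a @ [nx a] = us @ y # vs"
  shows "ins_nxt nx ws (last (a # us)) = y"
proof (cases us rule: rev_cases)
  case Nil
  have "\<not> (\<exists>b i. i < length (chain ws b) \<and> chain ws b ! i = a)"
    using a set_chain_subset[of ws] by (meson nth_mem subsetD)
  with Nil split show ?thesis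
    by (cases "chain ws a") (auto simp: ins_nxt_def)
next
  case (snoc us' p)
  let ?i = "length us'"
  have len: "?i < length (chain ws a)"
    using arg_cong[OF split, of length] snoc by simp
  have E: "chain ws a @ [nx a] = us' @ p # y # vs" using split snoc by simp
  have p: "chain ws a ! ?i = p"
    using E len by (metis nth_append nth_append_length)
  have y: "(chain ws a @ [nx a]) ! Suc ?i = y"
    unfolding E by (simp add: nth_append)
  have mem: "p \<in> set (chain ws a)" using p len nth_mem by blast
  \<comment> \<open>Inserted points are not anchors, so the first case of \<open>ins_nxt\<close> is
    excluded at \<open>p\<close>; distinctness of the inserted points then makes its definite
    description unique.\<close>
  have nil: "chain ws p = []"
    using anch mem set_chain_subset[of ws a] by (force simp: chain_def filter_empty_conv)
  have uniq: "b = a \<and> i = ?i" if "i < length (chain ws b)" "chain ws b ! i = p" for b i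
  proof -
    from that have "p \<in> set (chain ws b)" using nth_mem by blast
    with mem have "b = a" using chain_inject[OF dist] by blast
    with that p len show ?thesis using distinct_chain[OF dist, of a] by (auto simp: nth_eq_iff_index_eq)
  qed
  have the: "(THE q. \<exists>a i. i < length (chain ws a) \<and> chain ws a ! i = p
                              \<and> q = (chain ws a @ [nx a]) ! Suc i) = y"
  proof (rule the_equality)
    show "\<exists>a i. i < length (chain ws a) \<and> chain ws a ! i = p \<and> y = (chain ws a @ [nx a]) ! Suc i"
      using p y len by auto
    show "q = y" if "\<exists>a i. i < length (chain ws a) \<and> chain ws a ! i = p
        \<and> q = (chain ws a @ [nx a]) ! Suc i" for q
      using that uniq y by auto
  qed
  have ex: "\<exists>a i. i < length (chain ws a) \<and> chain ws a ! i = p" using p len by blast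
  have "ins_nxt nx ws p = y" unfolding ins_nxt_def nil list.case if_P[OF ex] by (rule the)
  with snoc show ?thesis by simp
qed

text \<open>Only surjectivity is shown directly, from the explicit predecessor of each point;
  injectivity follows because the two finite sets have equal cardinality.\<close>

lemma bij_betw_ins_nxt:
  assumes bij: "bij_betw nx A B" and fin: "finite A"
    and dist: "distinct (concat (map snd ws))"
    and anch: "fst ` set ws \<subseteq> A"
    and new: "set (concat (map snd ws)) \<inter> A = {}" "set (concat (map snd ws)) \<inter> B = {}"
  shows "bij_betw (ins_nxt nx ws) (A \<union> set (concat (map snd ws))) (B \<union> set (concat (map snd ws)))"
proof -
  let ?N = "set (concat (map snd ws))" and ?f = "ins_nxt nx ws"
  have anch': "fst ` set ws \<inter> ?N = {}" using anch new by blast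
  have step: "?f (last (a # us)) = y" if "a \<in> A" "chain ws a @ [nx a] = us @ y # vs" for a us y vs
    using ins_nxt_successor[OF dist anch', where a = a and us = us and y = y and vs = vs] that new by blast
  have chain_cover: "\<exists>a\<in>A. x \<in> set (chain ws a)" if "x \<in> ?N" for x
    using that anch by (force simp: set_chain)
  have last_in: "last (a # us) \<in> A \<union> ?N" if "a \<in> A" "chain ws a = us @ vs" for a us vs
  proof (cases us rule: rev_cases)
    case (snoc us' u)
    with that have "u \<in> set (chain ws a)" by simp
    with snoc show ?thesis using set_chain_subset[of ws a] by auto
  qed (use that in simp)
  have sur: "B \<union> ?N \<subseteq> ?f ` (A \<union> ?N)"
  proof
    fix y assume "y \<in> B \<union> ?N"
    then consider "y \<in> B" | "y \<in> ?N" by blast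
    then show "y \<in> ?f ` (A \<union> ?N)"
    proof cases
      case 1
      then obtain a where a: "a \<in> A" "y = nx a" using bij by (auto simp: bij_betw_def)
      then have "?f (last (a # chain ws a)) = y" by (intro step[of a "chain ws a" y "[]"]) auto
      with last_in[of a "chain ws a" "[]"] a show ?thesis by (metis append_Nil2 image_eqI)
    next
      case 2
      then obtain a where a: "a \<in> A" "y \<in> set (chain ws a)" using chain_cover by blast
      then obtain us vs where us: "chain ws a = us @ y # vs" by (meson split_list)
      then have "?f (last (a # us)) = y" using a by (intro step[of a us y "vs @ [nx a]"]) auto
      with last_in[of a us "y # vs"] a us show ?thesis by (metis image_eqI)
    qed
  qed
  have finB: "finite B" and cardAB: "card A = card B" 
    using bij fin by (auto simp: bij_betw_finite bij_betw_same_card)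
  have "card (A \<union> ?N) = card (B \<union> ?N)"
    using new fin finB cardAB by (simp add: card_Un_disjoint Int_commute)
  then have c: "card (A \<union> ?N) \<le> card (B \<union> ?N)" by simp
  have finAN: "finite (A \<union> ?N)" using fin by simp
  have "?f ` (A \<union> ?N) = B \<union> ?N"
    by (rule card_seteq[OF finite_imageI[OF finAN] sur le_trans[OF card_image_le[OF finAN] c], symmetric])
  moreover from this have "inj_on ?f (A \<union> ?N)"
    using finAN \<open>card (A \<union> ?N) = card (B \<union> ?N)\<close> by (intro eq_card_imp_inj_on) auto
  ultimately show ?thesis by (simp add: bij_betw_def)
qed

text \<open>An injective orbit confined to a finite set is periodic, and following the period
  backwards would give the start a preimage.\<close>

lemma walk_leaves:
  assumes "finite D" "inj_on f D" "s \<in> D" "s \<notin> f ` D"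
  shows "\<exists>n. (f ^^ n) s \<notin> D \<and> (\<forall>i<n. (f ^^ i) s \<in> D)"
proof -
  have "\<exists>n. (f ^^ n) s \<notin> D"
  proof (rule ccontr)
    assume "\<not> ?thesis"
    then have D: "(f ^^ n) s \<in> D" for n by blast
    have "inj (\<lambda>n. (f ^^ n) s)"
    proof (rule injI)
      have *: "(f ^^ m) s = (f ^^ n) s \<Longrightarrow> m \<le> n \<Longrightarrow> m = n" for m n
      proof (induction m arbitrary: n)
        case 0
        show ?case
        proof (cases n)
          case (Suc n')
          with 0 have "s = f ((f ^^ n') s)" by simp
          with D[of n'] assms(4) show ?thesis by blast
        qed simp
      next
        case (Suc m)
        then obtain n' where n': "n = Suc n'" by (cases n) auto
        with Suc.prems have "f ((f ^^ m) s) = f ((f ^^ n') s)" by simp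
        with D assms(2) have "(f ^^ m) s = (f ^^ n') s" by (auto simp: inj_on_def)
        with Suc n' show ?case by simp
      qed
      show "m = n" if "(f ^^ m) s = (f ^^ n) s" for m n
        using *[of m n] *[of n m] that by (cases "m \<le> n") auto
    qed
    then have "infinite (range (\<lambda>n. (f ^^ n) s))" by (simp add: range_inj_infinite)
    moreover have "range (\<lambda>n. (f ^^ n) s) \<subseteq> D" using D by blast
    ultimately show False using assms(1) finite_subset by blast
  qed
  then obtain n where "(f ^^ n) s \<notin> D" by blast
  then show ?thesis
    using exists_least_iff[of "\<lambda>n. (f ^^ n) s \<notin> D"] by auto
qed

text \<open>From a common point, injectivity lets both walks be followed backwards until one reaches
  its start; having no preimage, that start must be the other one's as well.\<close>

lemma walks_disjoint:
  assumes "inj_on f D" "s \<notin> f ` D" "s' \<notin> f ` D"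
    and "\<And>l. l < m \<Longrightarrow> (f ^^ l) s \<in> D" "\<And>l. l < n \<Longrightarrow> (f ^^ l) s' \<in> D"
    and "i < m" "j < n" "(f ^^ i) s = (f ^^ j) s'"
  shows "i = j \<and> s = s'"
  using assms(6-)
proof (induction i arbitrary: j)
  case 0
  show ?case
  proof (cases j)
    case (Suc j')
    with 0 have "s = f ((f ^^ j') s')" by simp
    moreover have "(f ^^ j') s' \<in> D" using assms(5) Suc 0 by simp
    ultimately show ?thesis using assms(2) by blast
  qed (use 0 in simp)
next
  case (Suc i)
  show ?case
  proof (cases j)
    case 0
    with Suc have "s' = f ((f ^^ i) s)" by simp
    moreover have "(f ^^ i) s \<in> D" using assms(4) Suc by simp
    ultimately show ?thesis using assms(3) by blast
  next
    case (Suc j')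
    with Suc.prems have "f ((f ^^ i) s) = f ((f ^^ j') s')" by simp
    moreover have "(f ^^ i) s \<in> D" "(f ^^ j') s' \<in> D" using assms(4,5) Suc Suc.prems by simp_all
    ultimately have "(f ^^ i) s = (f ^^ j') s'" using assms(1) by (auto simp: inj_on_def)
    with Suc.IH[of j'] Suc.prems Suc show ?thesis by simp
  qed
qed

lemma distinct_concat_nth:
  assumes "\<And>k. k < length V \<Longrightarrow> distinct (V ! k)"
    and "\<And>k k' x. k < length V \<Longrightarrow> k' < length V \<Longrightarrow> x \<in> set (V ! k) \<Longrightarrow> x \<in> set (V ! k') \<Longrightarrow> k = k'"
  shows "distinct (concat V)"
  using assms
proof (induction V)
  case (Cons v V)
  have "distinct (concat V)"
  proof (rule Cons.IH)
    fix k k' x assume "k < length V" "k' < length V" "x \<in> set (V ! k)" "x \<in> set (V ! k')"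
    then show "k = k'" using Cons.prems(2)[of "Suc k" "Suc k'" x] by simp
  qed (use Cons.prems(1)[of "Suc k" for k] in auto)
  moreover have "distinct v" using Cons.prems(1)[of 0] by simp
  moreover have "set v \<inter> set (concat V) = {}"
  proof (rule ccontr)
    assume "set v \<inter> set (concat V) \<noteq> {}"
    then obtain x w where "x \<in> set v" "w \<in> set V" "x \<in> set w" by auto
    then obtain k where "k < length V" "x \<in> set (V ! k)" by (metis in_set_conv_nth)
    with \<open>x \<in> set v\<close> show False using Cons.prems(2)[of 0 "Suc k" x] by simp
  qed
  ultimately show ?case by simp
qed simp

subsection \<open>Diagrams with slots\<close>

text \<open>Smoothing separated from travelling: exchange the two ends of a smoothed crossing, then
  follow the outgoing edge. As an involution it can be combined with any successor map.\<close>

definition sw :: "nat set \<Rightarrow> pt \<Rightarrow> pt" where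
  "sw S p = (case p of X c ov \<Rightarrow> X c (if c \<in> S then \<not> ov else ov) | Bd l \<Rightarrow> Bd l)"

lemma sw_simps [simp]:
  "sw S (X c ov) = X c (if c \<in> S then \<not> ov else ov)" "sw S (Bd l) = Bd l"
  by (simp_all add: sw_def)

lemma sw_sw [simp]: "sw S (sw S p) = p"
  by (cases p) auto

lemma sw_in_ends [simp]: "sw S p \<in> ends C \<longleftrightarrow> p \<in> ends C"
  by (cases p) (auto simp: ends_def)

lemma sstep_X: "sstep G S (X c ov) = nxt G (sw S (X c ov))"
  by (simp add: sstep_def)

lemma sstep_even: "even l \<Longrightarrow> sstep G S (Bd l) = nxt G (Bd l)"
  by (simp add: sstep_def)

lemma X_in_ends [simp]: "X c ov \<in> ends C \<longleftrightarrow> c \<in> C" and Bd_notin_ends [simp]: "Bd l \<notin> ends C"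
  by (auto simp: ends_def)

lemma ends_cases: "p \<in> ends C \<Longrightarrow> (\<And>c ov. p = X c ov \<Longrightarrow> c \<in> C \<Longrightarrow> P) \<Longrightarrow> P"
  by (auto simp: ends_def)

lemma in_srcs [simp]: "X c ov \<in> srcs G \<longleftrightarrow> c \<in> crs G" "Bd l \<in> srcs G \<longleftrightarrow> l < 2 * nstr G \<and> even l"
  by (auto simp: srcs_def ends_def)

lemma in_tgts [simp]: "X c ov \<in> tgts G \<longleftrightarrow> c \<in> crs G" "Bd l \<in> tgts G \<longleftrightarrow> l < 2 * nstr G \<and> odd l"
  by (auto simp: tgts_def ends_def)

lemma finite_ends: "finite C \<Longrightarrow> finite (ends C)"
proof -
  have "ends C = (\<lambda>(c, ov). X c ov) ` (C \<times> UNIV)" by (auto simp: ends_def)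
  then show "finite C \<Longrightarrow> finite (ends C)" by simp
qed

lemma finite_srcs: "finite (crs G) \<Longrightarrow> finite (srcs G)"
  by (auto simp: srcs_def finite_ends)

text \<open>The diagram \<open>G\<close> with marked places ("slots") on its edges: an element \<open>(a, l)\<close> of
  \<open>ss\<close> puts slot \<open>l\<close> on the edge starting at \<open>a\<close>.  Slots are encoded as boundary points with
  even numbers beyond those of \<open>G\<close>.\<close>

locale slotted =
  fixes G :: gd and ss :: "(pt \<times> nat) list" and N :: nat
  assumes wf: "wf_gd G"
    and anchors: "fst ` set ss \<subseteq> srcs G"
    and distinct_labels: "distinct (map snd ss)"
    and labels: "set (map snd ss) = {..<N}"
begin

definition sl :: "nat \<Rightarrow> pt" where
  "sl l = Bd (2 * (nstr G + l))"

definition unsl :: "pt \<Rightarrow> nat" where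
  "unsl p = (case p of Bd m \<Rightarrow> m div 2 - nstr G | X _ _ \<Rightarrow> 0)"

abbreviation "slots \<equiv> sl ` {..<N}"

definition out :: "pt \<Rightarrow> pt" where
  "out = ins_nxt (nxt G) (map (\<lambda>(a, l). (a, [sl l])) ss)"

text \<open>A traveller entering slot \<open>l\<close> leaves the site of the local modification through slot
  \<open>\<pi> ! l\<close>.\<close>

definition ostep :: "nat set \<Rightarrow> nat list \<Rightarrow> pt \<Rightarrow> pt" where
  "ostep S \<pi> p = (if p \<in> slots then out (sl (\<pi> ! unsl p))
     else case p of X c ov \<Rightarrow> out (sw S p) | Bd l \<Rightarrow> if even l then out p else p)"

text \<open>Several slots may share an edge, for instance when both strands of a second move lie on
  one edge; the order in \<open>ss\<close> is then the order of traversal.\<close>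

definition labs :: "pt \<Rightarrow> nat list" where
  "labs a = map snd (filter (\<lambda>x. fst x = a) ss)"

lemma unsl_sl [simp]: "unsl (sl l) = l"
  by (simp add: sl_def unsl_def)

lemma sl_inject [simp]: "sl l = sl m \<longleftrightarrow> l = m"
  by (simp add: sl_def)

lemma inj_sl: "inj_on sl A"
  by (simp add: inj_on_def)

lemma sl_notin [simp]: "sl l \<notin> srcs G" "sl l \<notin> tgts G" "sl l \<notin> ends C" "sl l \<noteq> X c ov"
  by (simp_all add: sl_def)

lemma odd_notin_slots [simp]: "odd m \<Longrightarrow> Bd m \<notin> slots"
  by (auto simp: sl_def)

lemma ostep_simps:
  "l < N \<Longrightarrow> ostep S \<pi> (sl l) = out (sl (\<pi> ! l))"
  "ostep S \<pi> (X c ov) = out (sw S (X c ov))"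
  "k < nstr G \<Longrightarrow> ostep S \<pi> (Bd (2 * k)) = out (Bd (2 * k))"
  "odd m \<Longrightarrow> ostep S \<pi> (Bd m) = Bd m"
  by (auto simp: ostep_def sl_def unsl_def)

lemma bij_nxt: "bij_betw (nxt G) (srcs G) (tgts G)" and fin: "finite (crs G)"
  using wf by (auto simp: wf_gd_def)

lemma chain_words: "chain (map (\<lambda>(a, l). (a, W l)) ss) a = concat (map W (labs a))"
  unfolding chain_def labs_def
  by (simp add: filter_map o_def split_beta)

lemma chain_slots: "chain (map (\<lambda>(a, l). (a, [sl l])) ss) a = map sl (labs a)"
  using chain_words[of "\<lambda>l. [sl l]"] by (simp add: concat_map_singleton)

lemma labs_less: "l \<in> set (labs a) \<Longrightarrow> l < N"
  using labels unfolding labs_def by auto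

lemma anchor_exists: "l < N \<Longrightarrow> \<exists>a ls rs. a \<in> srcs G \<and> labs a = ls @ l # rs"
proof -
  assume "l < N"
  then have "l \<in> snd ` set ss" using labels by auto
  then obtain a where "(a, l) \<in> set ss" by auto
  then have "a \<in> srcs G" "l \<in> set (labs a)" using anchors by (force simp: labs_def)+
  then show ?thesis by (meson split_list)
qed

lemma concat_slots: "concat (map snd (map (\<lambda>(a, l). (a, [sl l])) ss)) = map sl (map snd ss)"
  by (induction ss) auto

lemma out_successor:
  assumes "a \<in> srcs G" "labs a = ls @ rs"
  shows "out (last (a # map sl ls)) = hd (map sl rs @ [nxt G a])"
  unfolding out_def
proof (rule ins_nxt_successor)
  let ?L = "map (\<lambda>(a, l). (a, [sl l])) ss"
  show "distinct (concat (map snd ?L))"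
    unfolding concat_slots distinct_map[of sl] using distinct_labels inj_sl by blast
  have *: "set (concat (map snd ?L)) \<subseteq> range sl"
    unfolding concat_slots by auto
  show "a \<notin> set (concat (map snd ?L))" using assms * by auto
  have "fst ` set ?L = fst ` set ss" by force
  then show "fst ` set ?L \<inter> set (concat (map snd ?L)) = {}" using anchors * by fastforce
  show "chain ?L a @ [nxt G a] = map sl ls @ hd (map sl rs @ [nxt G a]) # tl (map sl rs @ [nxt G a])"
    unfolding chain_slots using assms(2) by simp
qed

lemma bij_out: "bij_betw out (srcs G \<union> slots) (tgts G \<union> slots)"
proof -
  let ?L = "map (\<lambda>(a, l). (a, [sl l])) ss"
  have c: "set (concat (map snd ?L)) = slots"
    unfolding concat_slots set_map[of sl] labels ..
  have f: "fst ` set ?L = fst ` set ss" by force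
  have "distinct (concat (map snd ?L))"
    unfolding concat_slots distinct_map[of sl] using distinct_labels inj_sl by blast
  moreover have "slots \<inter> srcs G = {}" "slots \<inter> tgts G = {}" by auto
  ultimately show ?thesis
    using bij_betw_ins_nxt[OF bij_nxt finite_srcs[OF fin], of ?L] anchors
    unfolding c f out_def by blast
qed

definition perms :: "nat list set" where
  "perms = {\<pi>. length \<pi> = N \<and> distinct \<pi> \<and> set \<pi> = {..<N}}"

lemma finite_perms: "finite perms"
  by (rule finite_subset[OF _ finite_lists_length_eq[of "{..<N}" N]]) (auto simp: perms_def)

lemma nth_perms_less: "\<pi> \<in> perms \<Longrightarrow> l < N \<Longrightarrow> \<pi> ! l < N"
  unfolding perms_def using nth_mem by fastforce

text \<open>\<open>\<sigma>\<close> is the order in which the strings of the slotted diagram enter the slots.\<close>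

definition admits :: "nat set \<Rightarrow> nat list \<Rightarrow> nat list \<Rightarrow> bool" where
  "admits S \<pi> \<sigma> \<longleftrightarrow> free G = 0 \<and> (\<exists>V. tracing (ostep S \<pi>) (nstr G) V
     \<and> ends (crs G) \<subseteq> set (concat V) \<and> (\<forall>c\<in>S. before (X c True) (X c False) (concat V))
     \<and> \<sigma> = map unsl (filter (\<lambda>p. p \<in> slots) (concat V)))"

context
  fixes S \<pi>
  assumes S: "S \<subseteq> crs G" and \<pi>: "\<pi> \<in> perms"
begin

lemma ostep_eq_out:
  "p \<in> srcs G \<union> slots \<Longrightarrow> ostep S \<pi> p = out (if p \<in> slots then sl (\<pi> ! unsl p) else sw S p)"
  by (cases "p \<in> slots"; cases p) (auto simp: ostep_def)

lemma ostep_closed: "p \<in> srcs G \<union> slots \<Longrightarrow> ostep S \<pi> p \<in> tgts G \<union> slots"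
proof -
  assume p: "p \<in> srcs G \<union> slots"
  have "(if p \<in> slots then sl (\<pi> ! unsl p) else sw S p) \<in> srcs G \<union> slots"
    using p nth_perms_less[OF \<pi>] by (cases p) (auto simp: unsl_sl)
  then show ?thesis
    unfolding ostep_eq_out[OF p] using bij_out by (auto simp: bij_betw_def)
qed

text \<open>On sources and slots the step is \<open>out\<close>, which is injective there, after a
  map that permutes the slots by \<open>\<pi>\<close>, acts on the other points by the involution
  \<open>sw S\<close>, and never mixes the two kinds.\<close>

lemma inj_ostep: "inj_on (ostep S \<pi>) (srcs G \<union> slots)"
proof (rule inj_onI)
  let ?t = "\<lambda>p. if p \<in> slots then sl (\<pi> ! unsl p) else sw S p"
  have t: "?t p \<in> srcs G \<union> slots" if "p \<in> srcs G \<union> slots" for p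
    using that nth_perms_less[OF \<pi>] by (cases p) auto
  fix p q assume pq: "p \<in> srcs G \<union> slots" "q \<in> srcs G \<union> slots" "ostep S \<pi> p = ostep S \<pi> q"
  then have "out (?t p) = out (?t q)" by (simp only: ostep_eq_out)
  then have eq: "?t p = ?t q" using t[OF pq(1)] t[OF pq(2)] bij_betw_imp_inj_on[OF bij_out]
    by (rule inj_onD[rotated])
  have sw_slot: "sw S x \<notin> slots" if "x \<in> srcs G" for x
    using that by (cases x) (auto simp: sl_def)
  have t_slot: "?t x \<in> slots \<longleftrightarrow> x \<in> slots" if "x \<in> srcs G \<union> slots" for x
    using that sw_slot[of x] nth_perms_less[OF \<pi>] by auto
  have slots: "p \<in> slots \<longleftrightarrow> q \<in> slots"
    using t_slot[OF pq(1)] t_slot[OF pq(2)] eq by simp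
  show "p = q"
  proof (cases "p \<in> slots")
    case True
    then have "q \<in> slots" using slots by simp
    with True eq have "\<pi> ! unsl p = \<pi> ! unsl q" "unsl p < N" "unsl q < N" by auto
    then have "unsl p = unsl q" using \<pi> by (simp add: perms_def nth_eq_iff_index_eq)
    with True \<open>q \<in> slots\<close> show ?thesis by auto
  next
    case False
    then have "q \<notin> slots" using slots by simp
    with False eq have "sw S p = sw S q" by simp
    then show ?thesis by (metis sw_sw)
  qed
qed

lemma start_notin_image: "Bd (2 * k) \<notin> ostep S \<pi> ` (srcs G \<union> slots)" if "k < nstr G"
proof
  assume "Bd (2 * k) \<in> ostep S \<pi> ` (srcs G \<union> slots)"
  then have "Bd (2 * k) \<in> tgts G \<union> slots" using ostep_closed by (metis imageE)
  with that show False by (auto simp: sl_def)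
qed

lemma tracing_nonterminal:
  assumes V: "tracing (ostep S \<pi>) (nstr G) V" and k: "k < nstr G"
  shows "set (V ! k) \<subseteq> srcs G \<union> slots"
proof -
  have *: "set xs \<subseteq> srcs G \<union> slots"
    if "path (ostep S \<pi>) x xs y" "x \<in> srcs G \<union> slots \<union> tgts G" "y \<notin> set xs" for x xs y
    using that
  proof (induction xs arbitrary: x)
    case (Cons u us)
    have u: "u = x" using Cons.prems by simp
    show ?case
    proof (cases "x \<in> srcs G \<union> slots")
      case True
      then show ?thesis using Cons ostep_closed[OF True] by auto
    next
      case False
      with Cons.prems(2) obtain m where m: "x = Bd m" "odd m" by (cases x) auto
      then have "ostep S \<pi> x = x" by (simp add: ostep_simps)
      \<comment> \<open>A path that reaches an output stays there, so the output would be both the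
        endpoint and a listed point.\<close>
      then have "y = x" using path_fixpoint[OF _ Cons.prems(1)] by simp
      with u Cons.prems show ?thesis by simp
    qed
  qed simp
  show ?thesis
    using *[of "Bd (2 * k)" "V ! k" "Bd (2 * k + 1)"] V k by (simp add: tracing_def)
qed

text \<open>Inputs have no preimage, so \<open>walks_disjoint\<close> applies to any two strings.
  Consequently each slot is entered at most once and \<open>\<sigma>\<close> has no
  repetition.\<close>

lemma distinct_tracing:
  assumes V: "tracing (ostep S \<pi>) (nstr G) V"
  shows "distinct (concat V)"
proof -
  let ?D = "srcs G \<union> slots" and ?f = "ostep S \<pi>"
  have len: "length V = nstr G" using V by (simp add: tracing_def)
  have nth: "V ! k ! i = (?f ^^ i) (Bd (2 * k))" if "k < nstr G" "i < length (V ! k)" for k i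
  proof -
    have "V ! k = map (\<lambda>i. (?f ^^ i) (Bd (2 * k))) [0..<length (V ! k)]"
      using V that by (simp add: tracing_def path_iff)
    then have "V ! k ! i = map (\<lambda>i. (?f ^^ i) (Bd (2 * k))) [0..<length (V ! k)] ! i" by simp
    with that(2) show ?thesis by simp
  qed
  have D: "(?f ^^ i) (Bd (2 * k)) \<in> ?D" if "k < nstr G" "i < length (V ! k)" for k i
    using nth[OF that] tracing_nonterminal[OF V that(1)] that(2) by (metis nth_mem subsetD)
  have eq: "i = j \<and> k = k'" if "k < nstr G" "k' < nstr G" "i < length (V ! k)" "j < length (V ! k')"
    "V ! k ! i = V ! k' ! j" for i j k k'
  proof -
    have "i = j \<and> Bd (2 * k) = Bd (2 * k')"
      using walks_disjoint[OF inj_ostep start_notin_image[OF that(1)] start_notin_image[OF that(2)]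
          D[OF that(1)] D[OF that(2)] that(3,4)] nth that by metis
    then show ?thesis by simp
  qed
  show ?thesis
  proof (rule distinct_concat_nth)
    fix k assume "k < length V"
    then show "distinct (V ! k)" using eq[of k k] len by (auto simp: distinct_conv_nth)
  next
    fix k k' x assume "k < length V" "k' < length V" "x \<in> set (V ! k)" "x \<in> set (V ! k')"
    then show "k = k'" using eq[of k k'] len by (metis in_set_conv_nth)
  qed
qed

text \<open>No coherence is assumed, hence the arbitrary output \<open>m\<close>. Which output it is
  gets decided later by comparison with the filled diagram.\<close>

lemma string_leaves:
  assumes "k < nstr G"
  obtains xs m where "path (ostep S \<pi>) (Bd (2 * k)) xs (Bd m)" "odd m" "m < 2 * nstr G"
    "set xs \<subseteq> srcs G \<union> slots"
proof -
  let ?D = "srcs G \<union> slots" and ?f = "ostep S \<pi>"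
  have "finite ?D" using finite_srcs[OF fin] by simp
  moreover have s: "Bd (2 * k) \<in> ?D" using assms by simp
  ultimately obtain n where n: "(?f ^^ n) (Bd (2 * k)) \<notin> ?D" "\<forall>i<n. (?f ^^ i) (Bd (2 * k)) \<in> ?D"
    using walk_leaves[OF _ inj_ostep s start_notin_image[OF assms]] by blast
  with s obtain n' where n': "n = Suc n'" by (cases n) auto
  have "(?f ^^ n) (Bd (2 * k)) \<in> tgts G \<union> slots"
    using ostep_closed[of "(?f ^^ n') (Bd (2 * k))"] n(2) n' by simp
  with n(1) obtain m where m: "(?f ^^ n) (Bd (2 * k)) = Bd m" "odd m" "m < 2 * nstr G"
    by (cases "(?f ^^ n) (Bd (2 * k))") auto
  show thesis
  proof (rule that)
    show "path ?f (Bd (2 * k)) (map (\<lambda>i. (?f ^^ i) (Bd (2 * k))) [0..<n]) (Bd m)"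
      using path_funpow[of ?f "Bd (2 * k)" n] m by simp
    show "set (map (\<lambda>i. (?f ^^ i) (Bd (2 * k))) [0..<n]) \<subseteq> ?D" using n(2) by auto
  qed (use m in auto)
qed

lemma admits_unique: "admits S \<pi> \<sigma> \<Longrightarrow> admits S \<pi> \<sigma>' \<Longrightarrow> \<sigma> = \<sigma>'"
  unfolding admits_def using tracing_unique ostep_simps(4) by (metis even_plus_one_iff dvd_triv_left)

lemma admits_distinct:
  assumes "admits S \<pi> \<sigma>" shows "distinct \<sigma>" "set \<sigma> \<subseteq> {..<N}"
proof -
  obtain V where V: "tracing (ostep S \<pi>) (nstr G) V"
    "\<sigma> = map unsl (filter (\<lambda>p. p \<in> slots) (concat V))"
    using assms unfolding admits_def by blast
  have "inj_on unsl slots" by (auto simp: inj_on_def)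
  then show "distinct \<sigma>" "set \<sigma> \<subseteq> {..<N}"
    using distinct_tracing[OF V(1)] V(2) by (auto simp: distinct_map intro: inj_on_subset)
qed

text \<open>If the modification reconnects nothing, every slot is passed right after its anchor or after
  the preceding slot on the same edge.\<close>

lemma admits_id:
  assumes "admits S \<pi> \<sigma>" and id: "\<pi> = [0..<N]"
  shows "set \<sigma> = {..<N}"
proof -
  obtain V where V: "tracing (ostep S \<pi>) (nstr G) V" "ends (crs G) \<subseteq> set (concat V)"
    "\<sigma> = map unsl (filter (\<lambda>p. p \<in> slots) (concat V))"
    using assms unfolding admits_def by blast
  \<comment> \<open>Slots are not outputs, so a string cannot stop on one.\<close>
  have closed: "ostep S \<pi> x \<in> set (concat V)"
    if x: "x \<in> set (concat V)" and slot: "ostep S \<pi> x \<in> slots" for x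
  proof -
    from x obtain k where k: "k < nstr G" "x \<in> set (V ! k)"
      using V(1) unfolding tracing_def by (auto simp: in_set_conv_nth[of _ V])
    then obtain us vs where us: "V ! k = us @ x # vs" by (meson split_list)
    have "path (ostep S \<pi>) (Bd (2 * k)) (V ! k) (Bd (2 * k + 1))"
      using V k by (simp add: tracing_def)
    then have p: "path (ostep S \<pi>) (ostep S \<pi> x) vs (Bd (2 * k + 1))"
      unfolding us path_append by auto
    moreover have "Bd (2 * k + 1) \<notin> slots" by simp
    ultimately have "vs \<noteq> []" using slot by (metis path.simps(1))
    with p have "ostep S \<pi> x \<in> set vs" by (cases vs) auto
    then have "ostep S \<pi> x \<in> set (V ! k)" using us by simp
    then show ?thesis using k V(1) by (auto simp: tracing_def)
  qed
  \<comment> \<open>In the smoothed diagram the edge leaving a crossing end \<open>a\<close> is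
    entered from \<open>sw S a\<close>, which is visited because all crossing ends are.\<close>
  have srcs: "\<exists>p. p \<in> set (concat V) \<and> ostep S \<pi> p = out a" if a: "a \<in> srcs G" for a
  proof (cases a)
    case (X c ov)
    have "ostep S \<pi> (sw S a) = out (sw S (sw S a))"
      using X by (simp add: ostep_simps)
    moreover have "sw S a \<in> set (concat V)"
      using V(2) a X by (intro subsetD[OF V(2)]) simp
    ultimately show ?thesis by (metis sw_sw)
  next
    case (Bd m)
    with a obtain k where k: "a = Bd (2 * k)" "k < nstr G" by auto
    have "path (ostep S \<pi>) (Bd (2 * k)) (V ! k) (Bd (2 * k + 1))"
      using V k by (simp add: tracing_def)
    then have "Bd (2 * k) \<in> set (V ! k)" by (cases "V ! k") auto
    then have "a \<in> set (concat V)" using k V(1) by (auto simp: tracing_def)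
    with k show ?thesis by (auto simp: ostep_simps)
  qed
  have vis: "sl l \<in> set (concat V)" if a: "a \<in> srcs G" "labs a = ls @ l # rs" for a l ls rs
    using a(2)
  proof (induction ls arbitrary: l rs rule: rev_induct)
    case Nil
    have "l < N" using labs_less[of l a] Nil by simp
    then have "sl l \<in> slots" by simp
    moreover have "out a = sl l" using out_successor[OF a(1), of "[]" "l # rs"] Nil by simp
    ultimately show ?case using srcs[OF a(1)] closed by metis
  next
    case (snoc m ls)
    have lm: "l < N" "m < N" using labs_less[of l a] labs_less[of m a] snoc.prems by simp_all
    have "sl m \<in> set (concat V)" using snoc by simp
    moreover have "out (sl m) = sl l"
      using out_successor[OF a(1), of "ls @ [m]" "l # rs"] snoc.prems by simp
    then have "ostep S \<pi> (sl m) = sl l" using lm id by (simp add: ostep_simps)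
    ultimately show ?case using closed[of "sl m"] lm by simp
  qed
  have "{..<N} \<subseteq> set \<sigma>"
  proof
    fix l assume "l \<in> {..<N}"
    then have "sl l \<in> set (concat V)" "sl l \<in> slots" using anchor_exists[of l] vis by auto
    then show "l \<in> set \<sigma>" unfolding V(3) by (force intro!: image_eqI[of l unsl "sl l"])
  qed
  with admits_distinct[OF assms(1)] show ?thesis by blast
qed

end

end

subsection \<open>Filling the slots\<close>

text \<open>\<open>lrun W N T p v m\<close>: travelling inside the words \<open>W 0, \<dots>, W (N - 1)\<close>, with the crossings
  of \<open>T\<close> smoothed, from \<open>p\<close> one visits \<open>v\<close> and then leaves through the end of \<open>W m\<close>.\<close>

inductive lrun :: "(nat \<Rightarrow> pt list) \<Rightarrow> nat \<Rightarrow> nat set \<Rightarrow> pt \<Rightarrow> pt list \<Rightarrow> nat \<Rightarrow> bool"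
  for W N T where
  leave: "l < N \<Longrightarrow> W l = us @ [sw T p] \<Longrightarrow> lrun W N T p [p] l"
| go: "l < N \<Longrightarrow> W l = us @ sw T p # q # vs \<Longrightarrow> lrun W N T q v m \<Longrightarrow> lrun W N T p (p # v) m"

text \<open>An empty word is passed without visiting anything and left through the same slot; this
  is the situation after crossings have been removed.\<close>

definition lent :: "(nat \<Rightarrow> pt list) \<Rightarrow> nat \<Rightarrow> nat set \<Rightarrow> nat \<Rightarrow> pt list \<Rightarrow> nat \<Rightarrow> bool" where
  "lent W N T l v m \<longleftrightarrow> (if W l = [] then v = [] \<and> m = l else lrun W N T (hd (W l)) v m)"

text \<open>The covering condition rules out closed components through the inserted crossings: an
  end missed by all strings lies on a circle.\<close>

definition local_desc :: "nat set \<Rightarrow> nat set \<Rightarrow> pt list \<Rightarrow> bool" where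
  "local_desc C T L \<longleftrightarrow> ends C \<subseteq> set L \<and> (\<forall>c\<in>T. before (X c True) (X c False) L)"

locale slotted_words = slotted +
  fixes C :: "nat set" and e :: "nat \<Rightarrow> int" and W :: "nat \<Rightarrow> pt list"
  assumes ok: "ins_ok G C e (map (\<lambda>(a, l). (a, W l)) ss)"
begin

abbreviation "ws \<equiv> map (\<lambda>(a, l). (a, W l)) ss"
abbreviation "G' \<equiv> insert_gd G C e ws"

lemma G'_simps [simp]: "nstr G' = nstr G" "crs G' = crs G \<union> C" "free G' = free G"
  "nxt G' = ins_nxt (nxt G) ws" "wr G' = (\<lambda>c. if c \<in> C then e c else wr G c)"
  by (simp_all add: insert_gd_def)

lemma C_disjoint: "C \<inter> crs G = {}" and fin_C: "finite C"
  and dist_ws: "distinct (concat (map snd ws))" and set_ws: "set (concat (map snd ws)) = ends C"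
  using ok by (simp_all add: ins_ok_def)

lemma words_subset: "l < N \<Longrightarrow> set (W l) \<subseteq> ends C"
proof -
  assume "l < N"
  then have "l \<in> snd ` set ss" using labels by auto
  then obtain a where "(a, l) \<in> set ss" by auto
  then have "(a, W l) \<in> set ws" by force
  then show ?thesis unfolding set_ws[symmetric] by force
qed

lemma srcs_disjoint: "srcs G \<inter> ends C = {}"
  using C_disjoint by (auto elim!: ends_cases)

lemma ins_successor:
  assumes "a \<in> srcs G" "concat (map W (labs a)) @ [nxt G a] = us @ y # vs"
  shows "ins_nxt (nxt G) ws (last (a # us)) = y"
proof (rule ins_nxt_successor[OF dist_ws])
  have "fst ` set ws = fst ` set ss" by force
  then show "fst ` set ws \<inter> set (concat (map snd ws)) = {}"
    unfolding set_ws using anchors srcs_disjoint by blast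
  show "a \<notin> set (concat (map snd ws))" unfolding set_ws using assms srcs_disjoint by blast
  show "chain ws a @ [nxt G a] = us @ y # vs" unfolding chain_words by (rule assms)
qed

lemma ins_nxt_word:
  assumes "l < N" "W l = us @ p # q # vs"
  shows "ins_nxt (nxt G) ws p = q"
proof -
  obtain a ls rs where a: "a \<in> srcs G" "labs a = ls @ l # rs" using anchor_exists[OF assms(1)] by blast
  then show ?thesis
    using ins_successor[OF a(1), of "concat (map W ls) @ us @ [p]" q "vs @ concat (map W rs) @ [nxt G a]"]
      assms(2) by simp
qed

text \<open>The \<open>hd\<close> skips empty words: it is the first letter of the next nonempty
  word on the edge, or the end of the edge if none follows.\<close>

lemma ins_nxt_word_end:
  assumes "a \<in> srcs G" "labs a = ls @ l # rs" "W l = us @ [p]"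
  shows "ins_nxt (nxt G) ws p = hd (concat (map W rs) @ [nxt G a])"
proof -
  let ?r = "concat (map W rs) @ [nxt G a]"
  have "?r = hd ?r # tl ?r" by simp
  then have "concat (map W (labs a)) @ [nxt G a] = (concat (map W ls) @ us @ [p]) @ hd ?r # tl ?r"
    using assms(2,3) by simp
  from ins_successor[OF assms(1) this] show ?thesis by simp
qed

lemma ins_nxt_anchor:
  assumes "a \<in> srcs G"
  shows "ins_nxt (nxt G) ws a = hd (concat (map W (labs a)) @ [nxt G a])"
proof -
  let ?r = "concat (map W (labs a)) @ [nxt G a]"
  have "?r = [] @ hd ?r # tl ?r" by simp
  from ins_successor[OF assms this] show ?thesis by simp
qed

text \<open>The point of \<open>G'\<close> at which one arrives when arriving at \<open>x\<close> in the slotted diagram; since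
  words may be empty, for a slot it may lie beyond the slot.\<close>

definition entry :: "pt \<Rightarrow> pt \<Rightarrow> bool" where
  "entry x y \<longleftrightarrow> (if x \<in> slots
     then \<exists>a ls rs. a \<in> srcs G \<and> labs a = ls @ unsl x # rs
            \<and> y = hd (concat (map W (unsl x # rs)) @ [nxt G a])
     else y = x)"

lemma entry_hd:
  assumes "a \<in> srcs G" "labs a = ls @ rs"
  shows "entry (hd (map sl rs @ [nxt G a])) (hd (concat (map W rs) @ [nxt G a]))"
proof (cases rs)
  case Nil
  have "nxt G a \<in> tgts G" using bij_nxt assms(1) by (auto simp: bij_betw_def)
  then have "nxt G a \<notin> slots" by auto
  with Nil show ?thesis by (simp add: entry_def)
next
  case (Cons r rs')
  then have "r < N" using labs_less[of r a] assms(2) by simp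
  with Cons assms show ?thesis by (auto simp: entry_def)
qed

lemma entry_out_slot:
  assumes "l < N" "W l = us @ [q]"
  shows "entry (out (sl l)) (ins_nxt (nxt G) ws q)"
proof -
  obtain a ls rs where a: "a \<in> srcs G" "labs a = ls @ l # rs" using anchor_exists[OF assms(1)] by blast
  have "out (sl l) = hd (map sl rs @ [nxt G a])"
    using out_successor[OF a(1), of "ls @ [l]" rs] a(2) by simp
  moreover have "ins_nxt (nxt G) ws q = hd (concat (map W rs) @ [nxt G a])"
    by (rule ins_nxt_word_end[OF a assms(2)])
  ultimately show ?thesis using entry_hd[OF a(1), of "ls @ [l]" rs] a(2) by simp
qed

text \<open>At an empty word the slotted traveller advances while the filled one stands still, so
  one point \<open>y\<close> represents both arrivals.\<close>

lemma entry_out_empty: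
  assumes "l < N" "W l = []" "entry (sl l) y"
  shows "entry (out (sl l)) y"
proof -
  obtain a ls rs where a: "a \<in> srcs G" "labs a = ls @ l # rs"
    and y: "y = hd (concat (map W rs) @ [nxt G a])"
    using assms by (auto simp: entry_def)
  have "out (sl l) = hd (map sl rs @ [nxt G a])"
    using out_successor[OF a(1), of "ls @ [l]" rs] a(2) by simp
  then show ?thesis using entry_hd[OF a(1), of "ls @ [l]" rs] a(2) y by simp
qed

lemma entry_out_anchor: "a \<in> srcs G \<Longrightarrow> entry (out a) (ins_nxt (nxt G) ws a)"
  using out_successor[of a "[]" "labs a"] entry_hd[of a "[]" "labs a"] by (simp add: ins_nxt_anchor)

lemma entry_nonempty: "l < N \<Longrightarrow> W l \<noteq> [] \<Longrightarrow> entry (sl l) y \<Longrightarrow> y = hd (W l)"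
  by (auto simp: entry_def)

lemma entry_nonslot: "x \<notin> slots \<Longrightarrow> entry x y \<longleftrightarrow> y = x"
  by (simp add: entry_def)

context
  fixes S T \<pi> vs
  assumes S: "S \<subseteq> crs G" and T: "T \<subseteq> C" and \<pi>: "\<pi> \<in> perms"
    and data: "\<And>l. l < N \<Longrightarrow> lent W N T l (vs ! l) (\<pi> ! l)"
begin

abbreviation "f' \<equiv> sstep G' (S \<union> T)"
abbreviation "fo \<equiv> ostep S \<pi>"

text \<open>The points passed in the filled diagram during one slotted step from \<open>x\<close>;
  the list is empty when \<open>x\<close> is a slot with an empty word.\<close>

definition expand :: "pt \<Rightarrow> pt list" where
  "expand x = (if x \<in> slots then vs ! unsl x else [x])"

lemma sstep_new: "sw T p \<in> ends C \<Longrightarrow> f' p = ins_nxt (nxt G) ws (sw T p)"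
proof -
  assume "sw T p \<in> ends C"
  then obtain c ov where p: "p = X c ov" "c \<in> C" by (auto elim: ends_cases)
  then have "c \<notin> S" using C_disjoint S by blast
  with p show ?thesis by (simp add: sstep_X)
qed

lemma lrun_path:
  "lrun W N T p v m \<Longrightarrow>
    m < N \<and> set v \<subseteq> ends C \<and> (\<exists>us q. W m = us @ [q] \<and> path f' p v (ins_nxt (nxt G) ws q))"
proof (induction rule: lrun.induct)
  case (leave l us p)
  then have "sw T p \<in> ends C" using words_subset[of l] by auto
  with leave show ?case by (auto simp: sstep_new)
next
  case (go l us p q vs' v m)
  then have p: "sw T p \<in> ends C" using words_subset[of l] by auto
  then have "f' p = q" using ins_nxt_word[OF go(1,2)] by (simp add: sstep_new)
  with go p show ?case by auto
qed

lemma data_subset: "l < N \<Longrightarrow> set (vs ! l) \<subseteq> ends C"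
  using data[of l] lrun_path by (auto simp: lent_def split: if_splits)

text \<open>The simulation step: a slot unfolds into its local run, which ends at the word of slot
  \<open>\<pi> ! l\<close>; every other point takes one ordinary step, governed by \<open>S\<close>
  alone because old and new crossings are disjoint.\<close>

lemma ostep_refined:
  assumes "x \<in> srcs G \<union> slots" "entry x y"
  shows "\<exists>y'. entry (fo x) y' \<and> path f' y (expand x) y'"
proof (cases "x \<in> slots")
  case True
  then obtain l where l: "x = sl l" "l < N" by auto
  have fo: "fo x = out (sl (\<pi> ! l))" using l by (simp add: ostep_simps)
  show ?thesis
  proof (cases "W l = []")
    case True
    then have "vs ! l = []" "\<pi> ! l = l" using data[OF l(2)] by (auto simp: lent_def)
    with l True assms fo entry_out_empty[OF l(2) True] show ?thesis
      by (auto simp: expand_def)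
  next
    case False
    then have "lrun W N T (hd (W l)) (vs ! l) (\<pi> ! l)" using data[OF l(2)] by (simp add: lent_def)
    from lrun_path[OF this] obtain us q where q: "\<pi> ! l < N" "W (\<pi> ! l) = us @ [q]"
      "path f' (hd (W l)) (vs ! l) (ins_nxt (nxt G) ws q)" by blast
    moreover have "y = hd (W l)" using entry_nonempty[OF l(2) False] assms l by simp
    ultimately show ?thesis
      using entry_out_slot[OF q(1,2)] fo l by (auto simp: expand_def)
  qed
next
  case False
  then have x: "x \<in> srcs G" "y = x" "expand x = [x]"
    using assms by (auto simp: entry_def expand_def)
  show ?thesis
  proof (cases x)
    case (X c ov)
    then have "c \<notin> C" using x C_disjoint by auto
    then have "f' x = ins_nxt (nxt G) ws (sw S x)" using X T by (auto simp: sstep_X)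
    moreover have "sw S x \<in> srcs G" using X x by simp
    moreover have "fo x = out (sw S x)" using X by (simp add: ostep_simps)
    ultimately show ?thesis using entry_out_anchor[of "sw S x"] x by auto
  next
    case (Bd m)
    with x obtain k where k: "x = Bd (2 * k)" "k < nstr G" by auto
    then have "f' x = ins_nxt (nxt G) ws x" by (simp add: sstep_even)
    moreover have "fo x = out x" using k by (simp add: ostep_simps)
    ultimately show ?thesis using entry_out_anchor[of x] x by auto
  qed
qed

lemma path_refined:
  "path fo x xs x' \<Longrightarrow> set xs \<subseteq> srcs G \<union> slots \<Longrightarrow> entry x y \<Longrightarrow>
    \<exists>y'. entry x' y' \<and> path f' y (concat (map expand xs)) y'"
proof (induction xs arbitrary: x y)
  case (Cons u us)
  then obtain z where z: "entry (fo x) z" "path f' y (expand x) z"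
    using ostep_refined[of x y] by auto
  with Cons.IH[of "fo x" z] Cons.prems show ?case
    by (auto simp: path_append)
qed auto

lemma string_refined:
  assumes "path fo (Bd (2 * k)) xs (Bd m)" "set xs \<subseteq> srcs G \<union> slots" "odd m" "k < nstr G"
  shows "path f' (Bd (2 * k)) (concat (map expand xs)) (Bd m) \<and> Bd m \<notin> set (concat (map expand xs))"
proof
  have "Bd (2 * k) \<notin> slots" using assms(4) by (auto simp: sl_def)
  then show "path f' (Bd (2 * k)) (concat (map expand xs)) (Bd m)"
    using path_refined[OF assms(1,2), of "Bd (2 * k)"] assms(3) by (auto simp: entry_nonslot)
  have "set (expand x) \<subseteq> srcs G \<union> ends C" if "x \<in> srcs G \<union> slots" for x
    using that data_subset[of "unsl x"] by (auto simp: expand_def)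
  then have "set (concat (map expand xs)) \<subseteq> srcs G \<union> ends C" using assms(2) by fastforce
  moreover have "Bd m \<notin> srcs G \<union> ends C" using assms(3) by simp
  ultimately show "Bd m \<notin> set (concat (map expand xs))" by blast
qed

text \<open>New crossing ends occur only in the expansions of slots, so restricting the expanded
  trace to them leaves the local runs in the order in which the slots are entered.\<close>

lemma filter_new:
  "set L \<subseteq> srcs G \<union> slots \<Longrightarrow> filter (\<lambda>p. p \<in> ends C) (concat (map expand L))
    = concat (map ((!) vs) (map unsl (filter (\<lambda>p. p \<in> slots) L)))"
proof (induction L)
  case (Cons x L)
  have "filter (\<lambda>p. p \<in> ends C) (expand x) = (if x \<in> slots then vs ! unsl x else [])"
    using Cons.prems data_subset[of "unsl x"] srcs_disjoint
    by (auto simp: expand_def filter_id_conv)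
  with Cons show ?case by auto
qed simp

lemma filter_old:
  "set L \<subseteq> srcs G \<union> slots \<Longrightarrow>
    filter (\<lambda>p. p \<notin> ends C) (concat (map expand L)) = filter (\<lambda>p. p \<notin> slots) L"
proof (induction L)
  case (Cons x L)
  have "filter (\<lambda>p. p \<notin> ends C) (expand x) = (if x \<in> slots then [] else [x])"
    using Cons.prems data_subset[of "unsl x"] srcs_disjoint
    by (auto simp: expand_def filter_empty_conv)
  with Cons show ?case by auto
qed simp

text \<open>Membership and \<open>before\<close> survive restriction to a sublist containing the
  points concerned. Filtering by old and new ends therefore separates the conditions on
  \<open>S\<close> from those on \<open>T\<close>.\<close>

lemma expand_conditions:
  assumes L: "set L \<subseteq> srcs G \<union> slots"
  shows "ends (crs G \<union> C) \<subseteq> set (concat (map expand L))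
      \<and> (\<forall>c\<in>S \<union> T. before (X c True) (X c False) (concat (map expand L)))
    \<longleftrightarrow> ends (crs G) \<subseteq> set L \<and> (\<forall>c\<in>S. before (X c True) (X c False) L)
      \<and> local_desc C T (concat (map ((!) vs) (map unsl (filter (\<lambda>p. p \<in> slots) L))))"
    (is "?l \<longleftrightarrow> ?r")
proof -
  let ?B = "concat (map expand L)"
  have old: "x \<in> set ?B \<longleftrightarrow> x \<in> set L" if "x \<in> ends (crs G)" for x
  proof -
    have "x \<notin> ends C" "x \<notin> slots" using that C_disjoint by (auto elim!: ends_cases simp: sl_def)
    with arg_cong[OF filter_old[OF L], of set] show ?thesis by auto
  qed
  have new: "x \<in> set ?B \<longleftrightarrow> x \<in> set (concat (map ((!) vs) (map unsl (filter (\<lambda>p. p \<in> slots) L))))"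
    if "x \<in> ends C" for x
    unfolding filter_new[OF L, symmetric] using that by simp
  have bold: "before (X c True) (X c False) ?B \<longleftrightarrow> before (X c True) (X c False) L" if "c \<in> S" for c
  proof -
    have c: "X c b \<notin> ends C" "X c b \<notin> slots" for b using that S C_disjoint by (auto simp: sl_def)
    have "before (X c True) (X c False) ?B
        \<longleftrightarrow> before (X c True) (X c False) (filter (\<lambda>p. p \<notin> ends C) ?B)"
      using c by (subst before_filter) auto
    also have "\<dots> \<longleftrightarrow> before (X c True) (X c False) L"
      unfolding filter_old[OF L] using c by (subst before_filter) auto
    finally show ?thesis .
  qed
  have bnew: "before (X c True) (X c False) ?B \<longleftrightarrow> before (X c True) (X c False)
      (concat (map ((!) vs) (map unsl (filter (\<lambda>p. p \<in> slots) L))))" if "c \<in> T" for c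
    unfolding filter_new[OF L, symmetric] using that T by (subst before_filter) auto
  have "ends (crs G \<union> C) = ends (crs G) \<union> ends C" by (auto simp: ends_def)
  then show ?thesis
    unfolding local_desc_def using old new bold bnew by (simp add: subset_iff ball_Un) blast
qed

lemma concat_map_expand:
  "concat (map (\<lambda>xs. concat (map expand xs)) V) = concat (map expand (concat V))"
  by (induction V) auto

text \<open>From right to left a slotted trace is expanded. From left to right the slotted trace has
  to be found: each slotted string leaves at some output, and its expansion must be the given string
  of the filled diagram.\<close>

theorem descending_insert:
  "descending G' (S \<union> T) \<longleftrightarrow> (\<exists>\<sigma>. admits S \<pi> \<sigma> \<and> local_desc C T (concat (map ((!) vs) \<sigma>)))"
proof
  assume "descending G' (S \<union> T)"
  then obtain V where free: "free G = 0" and V: "tracing f' (nstr G) V"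
    and cond: "ends (crs G \<union> C) \<subseteq> set (concat V)"
      "\<forall>c\<in>S \<union> T. before (X c True) (X c False) (concat V)"
    unfolding descending_iff by auto
  have "\<exists>xs. path fo (Bd (2 * k)) xs (Bd (2 * k + 1)) \<and> set xs \<subseteq> srcs G \<union> slots
      \<and> V ! k = concat (map expand xs)" if k: "k < nstr G" for k
  proof -
    obtain xs m where xs: "path fo (Bd (2 * k)) xs (Bd m)" "odd m" "set xs \<subseteq> srcs G \<union> slots"
      using string_leaves[OF S \<pi> k] by metis
    from string_refined[OF xs(1,3,2) k]
    have "path f' (Bd (2 * k)) (concat (map expand xs)) (Bd m)"
      "Bd m \<notin> set (concat (map expand xs))" by blast+
    moreover have "path f' (Bd (2 * k)) (V ! k) (Bd (2 * k + 1))" "Bd (2 * k + 1) \<notin> set (V ! k)"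
      using V k by (auto simp: tracing_def)
    \<comment> \<open>Uniqueness of paths identifies the two traces and at the same time the unknown
      output \<open>Bd m\<close> with the coherent one.\<close>
    ultimately have "V ! k = concat (map expand xs) \<and> Bd (2 * k + 1) = Bd m"
      using xs(2) by (intro path_unique[of f' "Bd (2 * k)"]) (auto simp: sstep_odd)
    with xs show ?thesis by auto
  qed
  then obtain U where U: "\<And>k. k < nstr G \<Longrightarrow> path fo (Bd (2 * k)) (U k) (Bd (2 * k + 1))
      \<and> set (U k) \<subseteq> srcs G \<union> slots \<and> V ! k = concat (map expand (U k))" by metis
  define V0 where "V0 = map U [0..<nstr G]"
  have "V = map (\<lambda>xs. concat (map expand xs)) V0"
    using V U by (intro nth_equalityI) (auto simp: tracing_def V0_def)
  then have cV: "concat V = concat (map expand (concat V0))"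
    by (simp add: concat_map_expand)
  have "\<forall>xs\<in>set V0. set xs \<subseteq> srcs G \<union> slots" using U by (simp add: V0_def)
  then have D: "set (concat V0) \<subseteq> srcs G \<union> slots" unfolding set_concat by blast
  have "Bd (2 * k + 1) \<notin> set (U k)" if "k < nstr G" for k
  proof -
    have "Bd (2 * k + 1) \<notin> srcs G \<union> slots" by simp
    with U[OF that] show ?thesis by blast
  qed
  with U have V0: "tracing fo (nstr G) V0" by (simp add: tracing_def V0_def)
  from cond expand_conditions[OF D] free V0
  show "\<exists>\<sigma>. admits S \<pi> \<sigma> \<and> local_desc C T (concat (map ((!) vs) \<sigma>))"
    unfolding admits_def cV by blast
next
  assume "\<exists>\<sigma>. admits S \<pi> \<sigma> \<and> local_desc C T (concat (map ((!) vs) \<sigma>))"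
  then obtain V0 where free: "free G = 0" and V0: "tracing fo (nstr G) V0"
    and cond: "ends (crs G) \<subseteq> set (concat V0)" "\<forall>c\<in>S. before (X c True) (X c False) (concat V0)"
      "local_desc C T (concat (map ((!) vs) (map unsl (filter (\<lambda>p. p \<in> slots) (concat V0)))))"
    unfolding admits_def by blast
  define V where "V = map (\<lambda>xs. concat (map expand xs)) V0"
  have cV: "concat V = concat (map expand (concat V0))"
    by (simp add: V_def concat_map_expand)
  have D: "set (V0 ! k) \<subseteq> srcs G \<union> slots" if "k < nstr G" for k
    by (rule tracing_nonterminal[OF S \<pi> V0 that])
  then have "\<forall>xs\<in>set V0. set xs \<subseteq> srcs G \<union> slots"
    using V0 unfolding tracing_def by (metis in_set_conv_nth)
  then have D': "set (concat V0) \<subseteq> srcs G \<union> slots" unfolding set_concat by blast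
  have "tracing f' (nstr G) V"
    using V0 D string_refined unfolding tracing_def V_def by auto
  with free cond expand_conditions[OF D'] S T show "descending G' (S \<union> T)"
    unfolding descending_iff cV[symmetric] by (auto simp del: set_concat)
qed

end

end

section \<open>The state sum split into outer and inner factors\<close>

context slotted
begin

definition adm :: "nat set \<Rightarrow> (nat list \<times> nat list) set" where
  "adm S = {(\<pi>, \<sigma>). \<pi> \<in> perms \<and> admits S \<pi> \<sigma>}"

text \<open>The order is determined by the permutation (\<open>admits_unique\<close>), and there are
  finitely many permutations.\<close>

lemma finite_adm: "S \<subseteq> crs G \<Longrightarrow> finite (adm S)"
proof -
  assume S: "S \<subseteq> crs G"
  have "inj_on fst (adm S)"
    using admits_unique[OF S] by (auto simp: inj_on_def adm_def)
  moreover have "finite (fst ` adm S)"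
    by (rule finite_subset[OF _ finite_perms]) (auto simp: adm_def)
  ultimately show ?thesis by (metis finite_imageD)
qed

lemma adm_cases:
  assumes "S \<subseteq> crs G" "(\<pi>, \<sigma>) \<in> adm S"
  shows "distinct \<sigma>" "set \<sigma> \<subseteq> {..<N}" "\<pi> = [0..<N] \<Longrightarrow> set \<sigma> = {..<N}"
  using assms admits_distinct[of S \<pi> \<sigma>] admits_id[of S \<pi> \<sigma>] by (auto simp: adm_def)

end

lemma sum_Pow_Un:
  assumes "finite A" "finite B" "A \<inter> B = {}"
  shows "(\<Sum>U\<in>Pow (A \<union> B). F U) = (\<Sum>S\<in>Pow A. \<Sum>T\<in>Pow B. F (S \<union> T))"
proof -
  have "bij_betw (\<lambda>(S, T). S \<union> T) (Pow A \<times> Pow B) (Pow (A \<union> B))"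
  proof (rule bij_betw_byWitness[where f' = "\<lambda>U. (U \<inter> A, U \<inter> B)"])
    show "\<forall>x\<in>Pow A \<times> Pow B. (\<lambda>U. (U \<inter> A, U \<inter> B)) ((\<lambda>(S, T). S \<union> T) x) = x"
      using assms(3) by fastforce
  qed auto
  then have "(\<Sum>U\<in>Pow (A \<union> B). F U) = (\<Sum>x\<in>Pow A \<times> Pow B. F ((\<lambda>(S, T). S \<union> T) x))"
    by (rule sum.reindex_bij_betw[symmetric])
  then show ?thesis by (simp add: sum.cartesian_product split_beta)
qed

text \<open>\<open>LD T\<close> packs the permutation realised by \<open>T\<close> with the points
  visited from each slot. For fixed \<open>S\<close> and \<open>T\<close> at most one pair of
  \<open>adm S\<close> contributes, so the sum over pairs merely encodes whether
  \<open>S \<union> T\<close> is descending; exchanging the sums then gathers all \<open>T\<close>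
  with equal behaviour towards the outside.\<close>

theorem (in slotted_words) conway_insert:
  assumes LD: "\<And>T. T \<subseteq> C \<Longrightarrow> fst (LD T) \<in> perms"
      "\<And>T l. T \<subseteq> C \<Longrightarrow> l < N \<Longrightarrow> lent W N T l (snd (LD T) ! l) (fst (LD T) ! l)"
  shows "conway G' = (\<Sum>S\<in>Pow (crs G). monom (ssign G S) (card S) * (\<Sum>(\<pi>, \<sigma>)\<in>adm S.
    \<Sum>T\<in>Pow C. if fst (LD T) = \<pi> \<and> local_desc C T (concat (map ((!) (snd (LD T))) \<sigma>))
      then monom (prod e T) (card T) else 0))"
proof -
  let ?L = "\<lambda>T \<sigma>. local_desc C T (concat (map ((!) (snd (LD T))) \<sigma>))"
  let ?m = "\<lambda>T. monom (prod e T) (card T)"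
  have summand: "(if descending G' (S \<union> T) then monom (ssign G' (S \<union> T)) (card (S \<union> T)) else 0)
      = monom (ssign G S) (card S) *
        (\<Sum>(\<pi>, \<sigma>)\<in>adm S. if fst (LD T) = \<pi> \<and> ?L T \<sigma> then ?m T else 0)"
    if ST: "S \<subseteq> crs G" "T \<subseteq> C" for S T
  proof -
    have disj: "S \<inter> T = {}" "finite S" "finite T"
      using ST C_disjoint fin fin_C by (auto intro: finite_subset)
    have "ssign G' (S \<union> T) = (\<Prod>c\<in>S. wr G' c) * (\<Prod>c\<in>T. wr G' c)"
      unfolding ssign_def using disj by (intro prod.union_disjoint) auto
    also have "(\<Prod>c\<in>S. wr G' c) = ssign G S"
      unfolding ssign_def using ST C_disjoint by (intro prod.cong) auto
    also have "(\<Prod>c\<in>T. wr G' c) = prod e T"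
      using ST by (intro prod.cong) auto
    finally have m: "monom (ssign G' (S \<union> T)) (card (S \<union> T)) = monom (ssign G S) (card S) * ?m T"
      using disj by (simp add: mult_monom card_Un_disjoint)
    have d: "descending G' (S \<union> T) \<longleftrightarrow> (\<exists>\<sigma>. admits S (fst (LD T)) \<sigma> \<and> ?L T \<sigma>)"
      by (rule descending_insert[OF ST LD[OF ST(2)]])
    have "(\<Sum>(\<pi>, \<sigma>)\<in>adm S. if fst (LD T) = \<pi> \<and> ?L T \<sigma> then ?m T else 0)
        = (if descending G' (S \<union> T) then ?m T else 0)"
    proof (cases "descending G' (S \<union> T)")
      case True
      then obtain \<sigma>0 where s0: "admits S (fst (LD T)) \<sigma>0" "?L T \<sigma>0" using d by blast
      have uniq: "\<sigma> = \<sigma>0" if "admits S (fst (LD T)) \<sigma>" for \<sigma>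
        by (rule admits_unique[OF ST(1) LD(1)[OF ST(2)] that s0(1)])
      have "(\<Sum>(\<pi>, \<sigma>)\<in>adm S. if fst (LD T) = \<pi> \<and> ?L T \<sigma> then ?m T else 0)
          = (\<Sum>x\<in>adm S. if x = (fst (LD T), \<sigma>0) then ?m T else 0)"
      proof (rule sum.cong[OF refl], clarify)
        fix \<pi> \<sigma> assume "(\<pi>, \<sigma>) \<in> adm S"
        then have "fst (LD T) = \<pi> \<and> ?L T \<sigma> \<longleftrightarrow> (\<pi>, \<sigma>) = (fst (LD T), \<sigma>0)"
          using uniq[of \<sigma>] s0(2) unfolding adm_def by blast
        then show "(if fst (LD T) = \<pi> \<and> ?L T \<sigma> then ?m T else 0)
            = (if (\<pi>, \<sigma>) = (fst (LD T), \<sigma>0) then ?m T else 0)" by presburger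
      qed
      moreover have "(fst (LD T), \<sigma>0) \<in> adm S" using s0 LD(1)[OF ST(2)] by (simp add: adm_def)
      ultimately show ?thesis using True finite_adm[OF ST(1)] by simp
    next
      case False
      then have "\<not> (fst (LD T) = \<pi> \<and> ?L T \<sigma>)" if "(\<pi>, \<sigma>) \<in> adm S" for \<pi> \<sigma>
        using d that unfolding adm_def by blast
      then have "(\<Sum>(\<pi>, \<sigma>)\<in>adm S. if fst (LD T) = \<pi> \<and> ?L T \<sigma> then ?m T else 0) = 0"
        by (intro sum.neutral) (auto simp only: split_paired_all prod.case if_False)
      with False show ?thesis by simp
    qed
    with m show ?thesis by simp
  qed
  have "finite (crs G')" using fin fin_C by simp
  then have "conway G' = (\<Sum>U\<in>Pow (crs G \<union> C).
      if descending G' U then monom (ssign G' U) (card U) else 0)"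
    by (simp only: conway_eq_sum G'_simps)
  also have "\<dots> = (\<Sum>S\<in>Pow (crs G). \<Sum>T\<in>Pow C.
      if descending G' (S \<union> T) then monom (ssign G' (S \<union> T)) (card (S \<union> T)) else 0)"
    using fin fin_C C_disjoint by (intro sum_Pow_Un) auto
  also have "\<dots> = (\<Sum>S\<in>Pow (crs G). \<Sum>T\<in>Pow C. monom (ssign G S) (card S) *
        (\<Sum>(\<pi>, \<sigma>)\<in>adm S. if fst (LD T) = \<pi> \<and> ?L T \<sigma> then ?m T else 0))"
    by (intro sum.cong refl summand) auto
  also have "\<dots> = (\<Sum>S\<in>Pow (crs G). monom (ssign G S) (card S) * (\<Sum>(\<pi>, \<sigma>)\<in>adm S.
    \<Sum>T\<in>Pow C. if fst (LD T) = \<pi> \<and> ?L T \<sigma> then ?m T else 0))"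
    unfolding sum_distrib_left[symmetric] split_beta by (subst sum.swap) (rule refl)
  finally show ?thesis .
qed

subsection \<open>Computing the local contribution\<close>

text \<open>A word as a successor table; \<open>Inr l\<close> means leaving through slot
  \<open>l\<close>.\<close>

fun links :: "nat \<Rightarrow> pt list \<Rightarrow> (pt \<times> (pt + nat)) list" where
  "links l [] = []"
| "links l [x] = [(x, Inr l)]"
| "links l (x # y # r) = (x, Inl y) # links l (y # r)"

text \<open>The counter bounds the number of steps, so that the traversal is a total, executable
  function. Failure gives \<open>None\<close>, which \<open>valid\<close> rules out by evaluation
  for every state, in place of a termination argument.\<close>

fun run :: "(pt \<times> (pt + nat)) list \<Rightarrow> nat list \<Rightarrow> nat \<Rightarrow> pt \<Rightarrow> (pt list \<times> nat) option" where
  "run K T 0 p = None"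
| "run K T (Suc k) p = (case map_of K (sw (set T) p) of
      None \<Rightarrow> None
    | Some (Inr l) \<Rightarrow> Some ([p], l)
    | Some (Inl q) \<Rightarrow> (case run K T k q of None \<Rightarrow> None | Some (v, m) \<Rightarrow> Some (p # v, m)))"

definition all_links :: "pt list list \<Rightarrow> (pt \<times> (pt + nat)) list" where
  "all_links Ws = concat (map (\<lambda>l. links l (Ws ! l)) [0..<length Ws])"

definition traverse :: "pt list list \<Rightarrow> nat list \<Rightarrow> nat \<Rightarrow> (pt list \<times> nat) option" where
  "traverse Ws T l = (case Ws ! l of
      [] \<Rightarrow> Some ([], l)
    | p # _ \<Rightarrow> let K = all_links Ws in run K T (length K) p)"

definition local_data :: "pt list list \<Rightarrow> nat list \<Rightarrow> nat list \<times> pt list list" where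
  "local_data Ws T = (let rs = map (\<lambda>l. the (traverse Ws T l)) [0..<length Ws]
     in (map snd rs, map fst rs))"

definition valid :: "nat \<Rightarrow> nat \<Rightarrow> pt list list \<Rightarrow> bool" where
  "valid N m Ws \<longleftrightarrow> length Ws = N
    \<and> list_all (list_all (\<lambda>p. case p of X c _ \<Rightarrow> c < m | Bd _ \<Rightarrow> False)) Ws
    \<and> list_all (\<lambda>T. list_all (\<lambda>l. traverse Ws T l \<noteq> None) [0..<N]
         \<and> distinct (fst (local_data Ws T)) \<and> list_all (\<lambda>l. l < N) (fst (local_data Ws T)))
       (subseqs [0..<m])"

definition local_desc_below :: "nat \<Rightarrow> nat list \<Rightarrow> pt list \<Rightarrow> bool" where
  "local_desc_below m T L \<longleftrightarrow> list_all (\<lambda>c. X c True \<in> set L \<and> X c False \<in> set L) [0..<m]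
    \<and> list_all (\<lambda>c. before (X c True) (X c False) L) T"

text \<open>Components: the key (permutation and exponent of the variable), the sign, the state, and
  the points visited from each slot. Tabulating them avoids repeating the traversals for every order
  of the slots.\<close>

type_synonym lstate = "(nat list \<times> nat) \<times> int \<times> nat list \<times> pt list list"

definition states :: "nat \<Rightarrow> pt list list \<Rightarrow> int list \<Rightarrow> lstate list" where
  "states m Ws es = map (\<lambda>T. let d = local_data Ws T
     in ((fst d, length T), prod_list (map ((!) es) T), T, snd d)) (subseqs [0..<m])"

definition weight :: "nat \<Rightarrow> lstate list \<Rightarrow> nat list \<Rightarrow> nat list \<times> nat \<Rightarrow> int" where
  "weight m st \<sigma> key = sum_list (map (\<lambda>(key', s, T, vs).
     if key' = key \<and> local_desc_below m T (concat (map ((!) vs) \<sigma>)) then s else 0) st)"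

text \<open>Sequences shorter than \<open>N\<close> are included, since a slot may lie on a closed
  component and be entered by no string.\<close>

definition orders :: "nat \<Rightarrow> nat list list" where
  "orders N = filter distinct (concat (map (\<lambda>r. List.n_lists r [0..<N]) [0..<Suc N]))"

text \<open>For the identity connection only orders of all slots occur (\<open>admits_id\<close>).  The other
  orders must be excluded here, because an empty word does not notice that its slot is missed.\<close>

definition agree :: "nat \<Rightarrow> nat \<Rightarrow> lstate list \<Rightarrow> nat \<Rightarrow> lstate list \<Rightarrow> bool" where
  "agree N m st m' st' \<longleftrightarrow> list_all (\<lambda>\<sigma>. list_all (\<lambda>key.
      (fst key = [0..<N] \<longrightarrow> length \<sigma> = N) \<longrightarrow> weight m st \<sigma> key = weight m' st' \<sigma> key)
      (map fst (st @ st'))) (orders N)"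

section \<open>Soundness of the executable traversal\<close>

lemma links_sound:
  "(x, Inr l') \<in> set (links l w) \<Longrightarrow> l' = l \<and> (\<exists>us. w = us @ [x])"
  "(x, Inl y) \<in> set (links l w) \<Longrightarrow> \<exists>us vs. w = us @ x # y # vs"
proof (induction l w rule: links.induct)
  case (3 l x' y' r)
  {
    case 1
    with 3(1) have "l' = l \<and> (\<exists>us. y' # r = us @ [x])" by auto
    then show ?case by (metis append_Cons)
  next
    case 2
    then consider "x = x'" "y = y'" | "(x, Inl y) \<in> set (links l (y' # r))" by auto
    then show ?case
    proof cases
      case 1
      then show ?thesis by (intro exI[of _ "[]"] exI[of _ r]) auto
    next
      case 2
      then obtain us vs where "y' # r = us @ x # y # vs" using 3(2) by blast
      then show ?thesis by (intro exI[of _ "x' # us"] exI[of _ vs]) auto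
    qed
  }
qed auto

lemma run_sound:
  "run (all_links Ws) T k p = Some (v, m) \<Longrightarrow> lrun ((!) Ws) (length Ws) (set T) p v m"
proof (induction k arbitrary: p v m)
  case (Suc k)
  from Suc.prems obtain z where z: "map_of (all_links Ws) (sw (set T) p) = Some z"
    by (auto split: option.splits)
  then obtain l where l: "l < length Ws" "(sw (set T) p, z) \<in> set (links l (Ws ! l))"
    by (auto simp: all_links_def dest!: map_of_SomeD)
  show ?case
  proof (cases z)
    case (Inl q)
    with Suc.prems z obtain v' where v': "run (all_links Ws) T k q = Some (v', m)" "v = p # v'"
      by (auto split: option.splits)
    from Inl l obtain us vs where "Ws ! l = us @ sw (set T) p # q # vs"
      using links_sound(2) by metis
    with l v' show ?thesis by (auto intro: lrun.go[OF l(1)] Suc.IH)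
  next
    case (Inr l')
    with Suc.prems z have v: "v = [p]" "m = l'" by auto
    from Inr l obtain us where "l' = l" "Ws ! l = us @ [sw (set T) p]"
      using links_sound(1) by metis
    with v l show ?thesis by (auto intro: lrun.leave)
  qed
qed simp

lemma traverse_sound:
  "traverse Ws T l = Some (v, m) \<Longrightarrow> lent ((!) Ws) (length Ws) (set T) l v m"
  by (auto simp: traverse_def lent_def Let_def dest: run_sound split: list.splits)

section \<open>Renaming the inserted crossings\<close>

lemma sw_mp: "inj_on g C \<Longrightarrow> p \<in> ends C \<Longrightarrow> T \<subseteq> C \<Longrightarrow> sw (g ` T) (mp g p) = mp g (sw T p)"
  by (auto elim!: ends_cases simp: inj_on_image_mem_iff)

text \<open>A run depends only on which letters coincide, so it is carried along by any injective
  renaming. This transfers evaluations with crossings \<open>0\<close>, ..., \<open>m - 1\<close> to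
  arbitrary names.\<close>

lemma lrun_mp:
  assumes g: "inj_on g C" "T \<subseteq> C" and W: "\<And>l. l < N \<Longrightarrow> set (W l) \<subseteq> ends C"
  shows "lrun W N T p v m \<Longrightarrow>
    lrun (\<lambda>l. map (mp g) (W l)) N (g ` T) (mp g p) (map (mp g) v) m \<and> set v \<subseteq> ends C"
proof (induction rule: lrun.induct)
  case (leave l us p)
  then have p: "p \<in> ends C" using W[of l] by auto
  have "map (mp g) (W l) = map (mp g) us @ [sw (g ` T) (mp g p)]"
    unfolding sw_mp[OF g(1) p g(2)] using leave by simp
  then have "lrun (\<lambda>l. map (mp g) (W l)) N (g ` T) (mp g p) [mp g p] l"
    by (intro lrun.leave leave)
  with p show ?case by simp
next
  case (go l us p q vs v m)
  then have p: "p \<in> ends C" using W[of l] by auto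
  have "map (mp g) (W l) = map (mp g) us @ sw (g ` T) (mp g p) # mp g q # map (mp g) vs"
    unfolding sw_mp[OF g(1) p g(2)] using go by simp
  then have "lrun (\<lambda>l. map (mp g) (W l)) N (g ` T) (mp g p) (mp g p # map (mp g) v) m"
    using go.IH by (intro lrun.go[OF go(1)]) auto
  with p go show ?case by simp
qed

lemma lent_mp:
  assumes g: "inj_on g C" "T \<subseteq> C" and W: "\<And>l. l < N \<Longrightarrow> set (W l) \<subseteq> ends C"
    and "lent W N T l v m"
  shows "lent (\<lambda>l. map (mp g) (W l)) N (g ` T) l (map (mp g) v) m" "set v \<subseteq> ends C"
  using assms(4) lrun_mp[OF assms(1,2) W, where p = "hd (W l)" and v = v and m = m]
  by (auto simp: lent_def hd_map split: if_splits)

lemma inj_on_mp: "inj_on g C \<Longrightarrow> inj_on (mp g) (ends C)"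
  by (auto simp: inj_on_def elim!: ends_cases)

lemma ends_subset_iff: "ends C \<subseteq> A \<longleftrightarrow> (\<forall>c\<in>C. X c True \<in> A \<and> X c False \<in> A)"
proof -
  have "p \<in> ends C \<longleftrightarrow> p \<in> (\<Union>c\<in>C. {X c True, X c False})" for p
  proof (cases p)
    case (X c ov)
    then show ?thesis by (cases ov) auto
  qed auto
  then show ?thesis by (auto simp: subset_iff)
qed

lemma local_desc_mp:
  assumes g: "inj_on g {..<m}" and L: "set L \<subseteq> ends {..<m}" and T: "set T \<subseteq> {..<m}"
  shows "local_desc (g ` {..<m}) (g ` set T) (map (mp g) L) \<longleftrightarrow> local_desc_below m T L"
proof -
  have inj: "inj_on (mp g) (ends {..<m})" by (rule inj_on_mp[OF g])
  have e: "ends (g ` {..<m}) = mp g ` ends {..<m}"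
  proof
    show "ends (g ` {..<m}) \<subseteq> mp g ` ends {..<m}"
    proof
      fix p assume "p \<in> ends (g ` {..<m})"
      then obtain c ov where "p = mp g (X c ov)" "X c ov \<in> ends {..<m}"
        by (auto elim!: ends_cases)
      then show "p \<in> mp g ` ends {..<m}" by blast
    qed
  qed (auto elim!: ends_cases)
  have "ends (g ` {..<m}) \<subseteq> set (map (mp g) L) \<longleftrightarrow> ends {..<m} \<subseteq> set L"
    unfolding e using inj_on_image_mem_iff[OF inj _ L] by (auto simp: image_subset_iff subset_iff)
  also have "\<dots> \<longleftrightarrow> (\<forall>c\<in>{..<m}. X c True \<in> set L \<and> X c False \<in> set L)"
    by (auto simp: ends_subset_iff)
  finally have 1: "ends (g ` {..<m}) \<subseteq> set (map (mp g) L)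
      \<longleftrightarrow> (\<forall>c\<in>{..<m}. X c True \<in> set L \<and> X c False \<in> set L)" .
  have "before (X (g c) True) (X (g c) False) (map (mp g) L) \<longleftrightarrow> before (X c True) (X c False) L"
    if "c \<in> set T" for c
  proof -
    have "insert (X c True) (insert (X c False) (set L)) \<subseteq> ends {..<m}" using that T L by auto
    from before_map[OF inj_on_subset[OF inj this]] show ?thesis by simp
  qed
  with 1 show ?thesis by (auto simp: local_desc_def local_desc_below_def list_all_iff)
qed

section \<open>Subsets represented by sublists\<close>

lemma filter_subseq: "distinct xs \<Longrightarrow> ys \<in> set (subseqs xs) \<Longrightarrow> filter (\<lambda>x. x \<in> set ys) xs = ys"
proof (induction xs arbitrary: ys)
  case (Cons x xs)
  then consider ys' where "ys = x # ys'" "ys' \<in> set (subseqs xs)" | "ys \<in> set (subseqs xs)"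
    by (auto simp: Let_def)
  then show ?case
  proof cases
    case 1
    have "filter (\<lambda>z. z \<in> set ys) xs = filter (\<lambda>z. z \<in> set ys') xs"
      using 1 Cons.prems by (intro filter_cong) auto
    with 1 Cons show ?thesis by simp
  next
    case 2
    then have "set ys \<subseteq> set xs" using subseqs_powset[of xs] by blast
    with 2 Cons show ?thesis by auto
  qed
qed simp

lemma filter_in_subseqs: "filter P xs \<in> set (subseqs xs)"
  by (induction xs) (auto simp: Let_def)

lemma sum_Pow_subseqs:
  assumes "distinct xs" "inj_on g (set xs)"
  shows "(\<Sum>T\<in>Pow (g ` set xs). F T) = sum_list (map (\<lambda>ys. F (g ` set ys)) (subseqs xs))"
proof -
  have "(\<Sum>T\<in>Pow (g ` set xs). F T) = (\<Sum>T\<in>Pow (set xs). F (g ` T))"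
    by (rule sum.reindex_cong[OF inj_on_image_Pow[OF assms(2)] image_Pow_surj[symmetric]]) auto
  also have "\<dots> = (\<Sum>T\<in>set (map set (subseqs xs)). F (g ` T))"
    using subseqs_powset[of xs] by simp
  also have "\<dots> = sum_list (map (\<lambda>T. F (g ` T)) (map set (subseqs xs)))"
    using distinct_set_subseqs[OF assms(1)] by (rule sum.distinct_set_conv_list)
  finally show ?thesis by (simp add: o_def)
qed

section \<open>From integer weights to polynomials\<close>

lemma coeff_sum_list: "coeff (sum_list (map F xs)) k = sum_list (map (\<lambda>x. coeff (F x) k) xs)"
  by (induction xs) auto

definition wpoly :: "nat \<Rightarrow> lstate list \<Rightarrow> nat list \<Rightarrow> nat list \<Rightarrow> int poly" where
  "wpoly m st \<pi> \<sigma> = sum_list (map (\<lambda>(key, s, T, vs).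
     if fst key = \<pi> \<and> local_desc_below m T (concat (map ((!) vs) \<sigma>)) then monom s (snd key) else 0) st)"

lemma coeff_wpoly: "coeff (wpoly m st \<pi> \<sigma>) k = weight m st \<sigma> (\<pi>, k)"
  unfolding wpoly_def weight_def coeff_sum_list
  by (intro arg_cong[of _ _ sum_list] map_cong refl) auto

lemma weight_absent: "key \<notin> fst ` set st \<Longrightarrow> weight m st \<sigma> key = 0"
  unfolding weight_def by (induction st) auto

text \<open>Keys occurring in neither table have weight zero on both sides, so the finitely many
  keys tested by \<open>agree\<close> decide every coefficient.\<close>

lemma wpoly_agree:
  assumes "agree N m st m' st'" "distinct \<sigma>" "set \<sigma> \<subseteq> {..<N}" "\<pi> = [0..<N] \<Longrightarrow> set \<sigma> = {..<N}"
  shows "wpoly m st \<pi> \<sigma> = wpoly m' st' \<pi> \<sigma>"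
proof (rule poly_eqI)
  fix k
  have len: "length \<sigma> = card (set \<sigma>)" using assms(2) by (simp add: distinct_card)
  also have "\<dots> \<le> N" using card_mono[OF _ assms(3)] by simp
  finally have "\<sigma> \<in> set (orders N)"
    using assms(2,3) by (auto simp: orders_def set_n_lists atLeast0LessThan)
  moreover have "\<pi> = [0..<N] \<longrightarrow> length \<sigma> = N" using len assms(4) by auto
  ultimately have "weight m st \<sigma> (\<pi>, k) = weight m' st' \<sigma> (\<pi>, k)"
    if "(\<pi>, k) \<in> set (map fst (st @ st'))"
    using assms(1)[unfolded agree_def list_all_iff, THEN bspec, THEN bspec, OF _ that] by simp
  then show "coeff (wpoly m st \<pi> \<sigma>) k = coeff (wpoly m' st' \<pi> \<sigma>) k"
    unfolding coeff_wpoly by (cases "(\<pi>, k) \<in> set (map fst (st @ st'))") (simp_all add: weight_absent)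
qed

text \<open>\<open>conway_insert\<close> with the data computed symbolically: \<open>g\<close> sends
  the standard names \<open>0\<close>, ..., \<open>m - 1\<close> to the actual crossings. The
  right-hand side involves \<open>g\<close> and \<open>e\<close> no longer.\<close>

lemma (in slotted) conway_insert_words:
  assumes g: "inj_on g {..<m}" and valid: "valid N m Ws"
    and e: "\<And>c. c < m \<Longrightarrow> e (g c) = es ! c"
    and ok: "ins_ok G (g ` {..<m}) e (map (\<lambda>(a, l). (a, map (mp g) (Ws ! l))) ss)"
  shows "conway (insert_gd G (g ` {..<m}) e (map (\<lambda>(a, l). (a, map (mp g) (Ws ! l))) ss))
    = (\<Sum>S\<in>Pow (crs G). monom (ssign G S) (card S) *
        (\<Sum>(\<pi>, \<sigma>)\<in>adm S. wpoly m (states m Ws es) \<pi> \<sigma>))"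
proof -
  let ?C = "g ` {..<m}" and ?W = "\<lambda>l. map (mp g) (Ws ! l)"
  interpret slotted_words G ss N ?C e ?W
    by unfold_locales (rule ok)
  have lenWs: "length Ws = N" using valid by (simp add: valid_def)
  have Wsub: "set (Ws ! l) \<subseteq> ends {..<m}" if "l < N" for l
  proof
    fix p assume "p \<in> set (Ws ! l)"
    then have "case p of X c _ \<Rightarrow> c < m | Bd _ \<Rightarrow> False"
      using valid that unfolding valid_def list_all_iff by (meson nth_mem)
    then show "p \<in> ends {..<m}" by (cases p) auto
  qed
  \<comment> \<open>The sublist of standard names whose \<open>g\<close>-image is \<open>T\<close>;
    it is the argument for which the executable functions were evaluated.\<close>
  define lst where "lst T = filter (\<lambda>c. g c \<in> T) [0..<m]" for T
  define LD where "LD T = (fst (local_data Ws (lst T)), map (map (mp g)) (snd (local_data Ws (lst T))))" for T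
  have lst: "lst T \<in> set (subseqs [0..<m])" "g ` set (lst T) = T" "set (lst T) \<subseteq> {..<m}"
    if "T \<subseteq> ?C" for T
    using that by (auto simp: lst_def filter_in_subseqs)
  have data: "lent ((!) Ws) N (set (lst T)) l (snd (local_data Ws (lst T)) ! l) (fst (local_data Ws (lst T)) ! l)"
    if "T \<subseteq> ?C" "l < N" for T l
  proof -
    have "traverse Ws (lst T) l \<noteq> None"
      using valid lst(1)[OF that(1)] that(2) unfolding valid_def list_all_iff by auto
    then obtain v m where "traverse Ws (lst T) l = Some (v, m)" by auto
    with traverse_sound[OF this] that(2) lenWs show ?thesis
      by (simp add: local_data_def Let_def)
  qed
  have len: "length (fst (local_data Ws T)) = N" "length (snd (local_data Ws T)) = N" for T
    using lenWs by (simp_all add: local_data_def Let_def)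
  have perm: "fst (LD T) \<in> perms" if "T \<subseteq> ?C" for T
  proof -
    let ?p = "fst (local_data Ws (lst T))"
    have "distinct ?p" "set ?p \<subseteq> {..<N}"
      using valid lst(1)[OF that] unfolding valid_def list_all_iff by auto
    \<comment> \<open>A repetition-free list of \<open>N\<close> numbers below \<open>N\<close> is a
      permutation, which is why \<open>valid\<close> tests only distinctness and the bound.\<close>
    moreover from this have "set ?p = {..<N}"
      using len[of "lst T"] by (intro card_subset_eq) (auto simp: distinct_card)
    ultimately show ?thesis using len by (simp add: LD_def perms_def)
  qed
  have LD: "lent ?W N T l (snd (LD T) ! l) (fst (LD T) ! l)" if "T \<subseteq> ?C" "l < N" for T l
    using lent_mp(1)[OF g lst(3)[OF that(1)] Wsub data[OF that]] that len
    by (simp add: LD_def lst(2)[OF that(1)])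
  have inner: "(\<Sum>T\<in>Pow ?C. if fst (LD T) = \<pi> \<and> local_desc ?C T (concat (map ((!) (snd (LD T))) \<sigma>))
      then monom (prod e T) (card T) else 0) = wpoly m (states m Ws es) \<pi> \<sigma>"
    if "set \<sigma> \<subseteq> {..<N}" for \<pi> \<sigma>
  proof -
    have "(\<Sum>T\<in>Pow ?C. if fst (LD T) = \<pi> \<and> local_desc ?C T (concat (map ((!) (snd (LD T))) \<sigma>))
      then monom (prod e T) (card T) else 0)
      = sum_list (map (\<lambda>ys. if fst (LD (g ` set ys)) = \<pi>
          \<and> local_desc ?C (g ` set ys) (concat (map ((!) (snd (LD (g ` set ys)))) \<sigma>))
        then monom (prod e (g ` set ys)) (card (g ` set ys)) else 0) (subseqs [0..<m]))"
      using sum_Pow_subseqs[of "[0..<m]" g] g by (simp add: atLeast0LessThan)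
    also have "\<dots> = sum_list (map (\<lambda>ys. if fst (local_data Ws ys) = \<pi>
          \<and> local_desc_below m ys (concat (map ((!) (snd (local_data Ws ys))) \<sigma>))
        then monom (prod_list (map ((!) es) ys)) (length ys) else 0) (subseqs [0..<m]))"
    proof (intro arg_cong[of _ _ sum_list] map_cong refl)
      fix ys assume ys: "ys \<in> set (subseqs [0..<m])"
      then have sub: "set ys \<subseteq> {..<m}"
        using subseqs_powset[of "[0..<m]"] by (auto simp: atLeast0LessThan)
      have dist: "distinct ys" using ys by (rule subseqs_distinctD) simp
      have "filter (\<lambda>c. g c \<in> g ` set ys) [0..<m] = filter (\<lambda>c. c \<in> set ys) [0..<m]"
        using g sub by (intro filter_cong) (auto simp: inj_on_image_mem_iff)
      then have l: "lst (g ` set ys) = ys"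
        using filter_subseq[OF _ ys] by (simp add: lst_def)
      have injy: "inj_on g (set ys)" using g sub by (rule inj_on_subset)
      have "prod e (g ` set ys) = (\<Prod>c\<in>set ys. e (g c))" using injy by (simp add: prod.reindex)
      also have "\<dots> = (\<Prod>c\<in>set ys. es ! c)" using e sub by (intro prod.cong) auto
      also have "\<dots> = prod_list (map ((!) es) ys)"
        using dist by (rule prod.distinct_set_conv_list)
      finally have p: "prod e (g ` set ys) = prod_list (map ((!) es) ys)" .
      have c: "card (g ` set ys) = length ys"
        using injy dist by (simp add: card_image distinct_card)
      have gys: "g ` set ys \<subseteq> ?C" using sub by blast
      let ?vs = "snd (local_data Ws ys)"
      have vsub: "set (?vs ! l) \<subseteq> ends {..<m}" if "l < N" for l
        using lent_mp(2)[OF g lst(3)[OF gys] Wsub data[OF gys that]] l by simp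
      have eqmap: "map ((!) (map (map (mp g)) ?vs)) \<sigma> = map (map (mp g) \<circ> (!) ?vs) \<sigma>"
        using that len by (intro map_cong refl) auto
      have "concat (map ((!) (snd (LD (g ` set ys)))) \<sigma>) = map (mp g) (concat (map ((!) ?vs) \<sigma>))"
        unfolding LD_def l snd_conv eqmap map_concat map_map by (rule refl)
      moreover have "set (concat (map ((!) ?vs) \<sigma>)) \<subseteq> ends {..<m}" using that vsub by fastforce
      ultimately have "local_desc ?C (g ` set ys) (concat (map ((!) (snd (LD (g ` set ys)))) \<sigma>))
          \<longleftrightarrow> local_desc_below m ys (concat (map ((!) ?vs) \<sigma>))"
        using local_desc_mp[OF g _ sub] by simp
      with p c l show "(if fst (LD (g ` set ys)) = \<pi>
          \<and> local_desc ?C (g ` set ys) (concat (map ((!) (snd (LD (g ` set ys)))) \<sigma>))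
        then monom (prod e (g ` set ys)) (card (g ` set ys)) else 0) =
        (if fst (local_data Ws ys) = \<pi> \<and> local_desc_below m ys (concat (map ((!) ?vs) \<sigma>))
        then monom (prod_list (map ((!) es) ys)) (length ys) else 0)"
        by (simp add: LD_def)
    qed
    also have "\<dots> = wpoly m (states m Ws es) \<pi> \<sigma>"
      unfolding wpoly_def states_def by (simp add: o_def Let_def cong: if_cong)
    finally show ?thesis .
  qed
  have "conway G' = (\<Sum>S\<in>Pow (crs G). monom (ssign G S) (card S) * (\<Sum>(\<pi>, \<sigma>)\<in>adm S.
    \<Sum>T\<in>Pow ?C. if fst (LD T) = \<pi> \<and> local_desc ?C T (concat (map ((!) (snd (LD T))) \<sigma>))
      then monom (prod e T) (card T) else 0))"
    by (rule conway_insert) (use perm LD in auto)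
  also have "\<dots> = (\<Sum>S\<in>Pow (crs G). monom (ssign G S) (card S) *
        (\<Sum>(\<pi>, \<sigma>)\<in>adm S. wpoly m (states m Ws es) \<pi> \<sigma>))"
  proof (intro sum.cong refl arg_cong2[of _ _ _ _ "(*)"], clarify)
    fix S \<pi> \<sigma> assume "S \<subseteq> crs G" "(\<pi>, \<sigma>) \<in> adm S"
    then show "(\<Sum>T\<in>Pow ?C. if fst (LD T) = \<pi> \<and> local_desc ?C T (concat (map ((!) (snd (LD T))) \<sigma>))
      then monom (prod e T) (card T) else 0) = wpoly m (states m Ws es) \<pi> \<sigma>"
      by (intro inner adm_cases(2))
  qed
  finally show ?thesis .
qed

theorem conway_replace:
  assumes "slotted G ss N" and ag: "agree N m (states m Ws es) m' (states m' Ws' es')"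
    and "inj_on g {..<m}" "valid N m Ws" "\<And>c. c < m \<Longrightarrow> e (g c) = es ! c"
      "ins_ok G (g ` {..<m}) e (map (\<lambda>(a, l). (a, map (mp g) (Ws ! l))) ss)"
    and "inj_on g' {..<m'}" "valid N m' Ws'" "\<And>c. c < m' \<Longrightarrow> e' (g' c) = es' ! c"
      "ins_ok G (g' ` {..<m'}) e' (map (\<lambda>(a, l). (a, map (mp g') (Ws' ! l))) ss)"
  shows "conway (insert_gd G (g ` {..<m}) e (map (\<lambda>(a, l). (a, map (mp g) (Ws ! l))) ss))
    = conway (insert_gd G (g' ` {..<m'}) e' (map (\<lambda>(a, l). (a, map (mp g') (Ws' ! l))) ss))"
proof -
  interpret slotted G ss N by (rule assms(1))
  have eq: "(\<Sum>S\<in>Pow (crs G). monom (ssign G S) (card S) *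
        (\<Sum>(\<pi>, \<sigma>)\<in>adm S. wpoly m (states m Ws es) \<pi> \<sigma>))
    = (\<Sum>S\<in>Pow (crs G). monom (ssign G S) (card S) *
        (\<Sum>(\<pi>, \<sigma>)\<in>adm S. wpoly m' (states m' Ws' es') \<pi> \<sigma>))"
  proof (intro sum.cong refl arg_cong2[of _ _ _ _ "(*)"])
    fix S x assume S: "S \<in> Pow (crs G)" "x \<in> adm S"
    obtain \<pi> \<sigma> where x: "x = (\<pi>, \<sigma>)" by (cases x)
    have "wpoly m (states m Ws es) \<pi> \<sigma> = wpoly m' (states m' Ws' es') \<pi> \<sigma>"
      using S adm_cases[of S \<pi> \<sigma>] unfolding x by (intro wpoly_agree[OF ag]) auto
    then show "(case x of (\<pi>, \<sigma>) \<Rightarrow> wpoly m (states m Ws es) \<pi> \<sigma>)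
        = (case x of (\<pi>, \<sigma>) \<Rightarrow> wpoly m' (states m' Ws' es') \<pi> \<sigma>)" by (simp add: x)
  qed
  show ?thesis
    by (rule trans[OF conway_insert_words[OF assms(3-6)]
          trans[OF eq sym[OF conway_insert_words[OF assms(7-10)]]]])
qed

subsection \<open>Reidemeister moves\<close>

definition locally_equal :: "nat \<Rightarrow> nat \<Rightarrow> pt list list \<Rightarrow> int list \<Rightarrow> nat \<Rightarrow> pt list list \<Rightarrow> int list \<Rightarrow> bool" where
  "locally_equal N m Ws es m' Ws' es' \<longleftrightarrow> valid N m Ws \<and> valid N m' Ws'
     \<and> agree N m (states m Ws es) m' (states m' Ws' es')"

text \<open>Smoothing the kink cuts off a circle, so one end is never visited and the state counts
  0, whatever the sign. Without smoothing both ends are visited once the slot is entered, as for the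
  empty word.\<close>

lemma r1_check:
  "list_all (\<lambda>ov. list_all (\<lambda>\<epsilon>. locally_equal 1 1 [[X 0 ov, X 0 (\<not> ov)]] [\<epsilon>] 0 [[]] []) [1, -1]) [True, False]"
  by code_simp

definition r2_words :: "bool \<Rightarrow> bool \<Rightarrow> pt list list" where
  "r2_words ov r = [[X 0 ov, X 1 ov],
     if r then [X 1 (\<not> ov), X 0 (\<not> ov)] else [X 0 (\<not> ov), X 1 (\<not> ov)]]"

text \<open>The unsmoothed state matches the empty words. The two states with one smoothed crossing
  induce the same permutation, are descending for the same orders and have opposite signs. Smoothing
  both crossings cuts off a circle for antiparallel strands; for parallel ones, whichever strand
  comes first enters one of the two crossings from below.\<close>

lemma r2_check:
  "list_all (\<lambda>ov. list_all (\<lambda>r. list_all (\<lambda>\<epsilon>. locally_equal 2 2 (r2_words ov r) [\<epsilon>, -\<epsilon>] 0 [[], []] [])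
    [1, -1]) [True, False]) [True, False]"
  by code_simp

text \<open>Crossings 0, 1, 2 stand for \<open>c01\<close>, \<open>c02\<close>, \<open>c12\<close>;
  the words belong to the top, middle and bottom strand.\<close>

definition r3_words :: "bool \<Rightarrow> bool \<Rightarrow> bool \<Rightarrow> pt list list" where
  "r3_words b0 b1 b2 =
    [if b0 then [X 0 True, X 1 True] else [X 1 True, X 0 True],
     if b1 then [X 0 False, X 2 True] else [X 2 True, X 0 False],
     if b2 then [X 1 False, X 2 False] else [X 2 False, X 1 False]]"

definition r3_check :: "bool \<Rightarrow> bool \<Rightarrow> bool \<Rightarrow> bool" where
  "r3_check b0 b1 b2 \<longleftrightarrow> list_all (\<lambda>e. list_all (\<lambda>e'. list_all (\<lambda>e''.
     r3_ok b0 b1 b2 e e' e'' \<longrightarrow>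
     locally_equal 3 3 (r3_words b0 b1 b2) [e, e', e''] 3 (map rev (r3_words b0 b1 b2)) [e, e', e''])
    [1, -1]) [1, -1]) [1, -1]"

lemma r3_check_TT: "r3_check True True True" "r3_check True True False"
  by code_simp+

lemma r3_check_TF: "r3_check True False True" "r3_check True False False"
  by code_simp+

lemma r3_check_FT: "r3_check False True True" "r3_check False True False"
  by code_simp+

lemma r3_check_FF: "r3_check False False True" "r3_check False False False"
  by code_simp+

lemma r3_check_all: "r3_check b0 b1 b2"
  using r3_check_TT r3_check_TF r3_check_FT r3_check_FF by (cases b0; cases b1; cases b2) simp_all

section \<open>Invariance under isomorphism\<close>

lemma sstep_closed:
  assumes "wf_gd G" "p \<in> srcs G \<union> tgts G"
  shows "sstep G S p \<in> srcs G \<union> tgts G"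
proof -
  have n: "nxt G q \<in> tgts G" if "q \<in> srcs G" for q
    using assms(1) that by (auto simp: wf_gd_def bij_betw_def)
  show ?thesis
  proof (cases p)
    case (X c ov)
    with assms(2) have "sw S p \<in> srcs G" by simp
    with X n show ?thesis by (simp add: sstep_X)
  next
    case (Bd l)
    with assms(2) n[of p] show ?thesis by (cases "even l") (auto simp: sstep_even sstep_odd)
  qed
qed

lemma walk_closed: "wf_gd G \<Longrightarrow> k < nstr G \<Longrightarrow> walk G S k i \<in> srcs G \<union> tgts G"
proof (induction i)
  case (Suc i)
  then show ?case using sstep_closed[of G "walk G S k i" S] by (simp add: walk_def)
qed (simp add: walk_def)

lemma iso_sstep:
  assumes f: "inj_on f (crs G)" and nxt: "\<forall>p\<in>srcs G. nxt G' (mp f p) = mp f (nxt G p)"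
    and S: "S \<subseteq> crs G" and p: "p \<in> srcs G \<union> tgts G"
  shows "sstep G' (f ` S) (mp f p) = mp f (sstep G S p)"
proof (cases p)
  case (X c ov)
  with p have c: "c \<in> crs G" by simp
  then have "sw (f ` S) (mp f p) = mp f (sw S p)" using f S X by (intro sw_mp) auto
  moreover have "sw S p \<in> srcs G" using c X by simp
  moreover have "sstep G' (f ` S) (mp f p) = nxt G' (sw (f ` S) (mp f p))"
    unfolding X mp.simps by (rule sstep_X)
  moreover have "sstep G S p = nxt G (sw S p)" unfolding X by (rule sstep_X)
  ultimately show ?thesis using nxt by metis
next
  case (Bd l)
  with p have "even l \<Longrightarrow> p \<in> srcs G" by auto
  with Bd nxt[rule_format, of p] show ?thesis
    by (cases "even l") (simp_all add: sstep_even sstep_odd)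
qed

lemma conway_iso:
  assumes wf: "wf_gd G" "wf_gd G'" and "iso G G'"
  shows "conway G = conway G'"
proof -
  from assms(3) obtain f where n: "nstr G' = nstr G" "free G' = free G"
    and f: "inj_on f (crs G)" and C: "crs G' = f ` crs G"
    and nxt: "\<forall>p\<in>srcs G. nxt G' (mp f p) = mp f (nxt G p)"
    and wr: "\<forall>c\<in>crs G. wr G' (f c) = wr G c" unfolding iso_def by blast
  have fin: "finite (crs G)" using wf by (simp add: wf_gd_def)
  have desc: "descending G' (f ` S) \<longleftrightarrow> descending G S" if S: "S \<subseteq> crs G" for S
  proof -
    have w: "walk G' (f ` S) k i = mp f (walk G S k i)" if "k < nstr G" for k i
    proof (induction i)
      case (Suc i)
      then show ?case
        using iso_sstep[OF f nxt S walk_closed[OF wf(1) that]] by (simp add: walk_def)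
    qed (simp add: walk_def)
    have X: "walk G' (f ` S) k i = X (f c) ov \<longleftrightarrow> walk G S k i = X c ov"
      if "k < nstr G" "c \<in> crs G" for k i c ov
      using walk_closed[OF wf(1) that(1), of S i] f that(2) w[OF that(1)]
      by (cases "walk G S k i") (auto simp: inj_on_eq_iff)
    have B: "walk G' (f ` S) k i = Bd l \<longleftrightarrow> walk G S k i = Bd l" if "k < nstr G" for k i l
      using w[OF that] by (cases "walk G S k i") auto
    have "f ` S \<subseteq> crs G'" using S C by blast
    moreover have "(\<forall>p\<in>ends (crs G'). \<exists>k<nstr G. visits G' (f ` S) k p) \<longleftrightarrow>
      (\<forall>p\<in>ends (crs G). \<exists>k<nstr G. visits G S k p)"
    proof -
      have ends: "(\<forall>p\<in>ends D. P p) \<longleftrightarrow> (\<forall>c\<in>D. \<forall>ov. P (X c ov))" for D P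
        by (auto simp: ends_def)
      have V: "visits G' (f ` S) k (X (f c) ov) \<longleftrightarrow> visits G S k (X c ov)"
        if "k < nstr G" "c \<in> crs G" for k c ov
        using X[OF that] by (simp add: visits_def)
      show ?thesis unfolding ends C ball_simps(9) using V by blast
    qed
    ultimately have coh: "coherent G' (f ` S) \<longleftrightarrow> coherent G S"
      unfolding coherent_def n using S B by (simp add: visits_def)
    have "(\<exists>k i k' i'. k < nstr G \<and> k' < nstr G \<and> walk G' (f ` S) k i = X (f c) True
          \<and> walk G' (f ` S) k' i' = X (f c) False \<and> (k < k' \<or> (k = k' \<and> i < i')))
        \<longleftrightarrow> (\<exists>k i k' i'. k < nstr G \<and> k' < nstr G \<and> walk G S k i = X c True
          \<and> walk G S k' i' = X c False \<and> (k < k' \<or> (k = k' \<and> i < i')))" if "c \<in> S" for c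
    proof -
      have "c \<in> crs G" using that S by blast
      then show ?thesis by (intro iff_exI conj_cong refl) (simp_all add: X)
    qed
    with coh show ?thesis unfolding descending_def n by simp
  qed
  have "conway G' = (\<Sum>U\<in>Pow (f ` crs G). if descending G' U then monom (ssign G' U) (card U) else 0)"
    using fin by (subst conway_eq_sum) (simp_all add: C)
  also have "\<dots> = (\<Sum>S\<in>Pow (crs G).
      if descending G' (f ` S) then monom (ssign G' (f ` S)) (card (f ` S)) else 0)"
    by (rule sum.reindex_cong[OF inj_on_image_Pow[OF f] image_Pow_surj[symmetric]]) auto
  also have "\<dots> = (\<Sum>S\<in>Pow (crs G). if descending G S then monom (ssign G S) (card S) else 0)"
  proof (rule sum.cong[OF refl])
    fix S assume "S \<in> Pow (crs G)"
    then have S: "S \<subseteq> crs G" by blast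
    then have inj: "inj_on f S" using f inj_on_subset by blast
    have "ssign G' (f ` S) = ssign G S"
      unfolding ssign_def prod.reindex[OF inj] using S wr by (intro prod.cong) auto
    then show "(if descending G' (f ` S) then monom (ssign G' (f ` S)) (card (f ` S)) else 0)
       = (if descending G S then monom (ssign G S) (card S) else 0)"
      using desc[OF S] card_image[OF inj] by simp
  qed
  also have "\<dots> = conway G" using fin by (simp add: conway_eq_sum)
  finally show ?thesis by simp
qed

section \<open>Circles without crossings\<close>

lemma conway_free: "finite (crs G) \<Longrightarrow> free G \<noteq> 0 \<Longrightarrow> conway G = 0"
  by (simp add: conway_eq_sum descending_iff)

text \<open>Both sides vanish. Before the move there is a free circle; afterwards the new crossing
  lies on a component of its own, which no string enters in any smoothing, so its ends are never
  visited.\<close>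

lemma conway_R1free:
  assumes wf: "wf_gd G" and "R1free G G'"
  shows "conway G = conway G'"
proof -
  from assms(2) obtain m c ov e where free: "free G = Suc m" and c: "c \<notin> crs G"
    and G': "G' = G\<lparr>free := m, crs := crs G \<union> {c},
                nxt := (nxt G)(X c ov := X c (\<not> ov), X c (\<not> ov) := X c ov),
                wr := (wr G)(c := e)\<rparr>" unfolding R1free_def by blast
  have fin: "finite (crs G)" using wf by (simp add: wf_gd_def)
  have "\<not> coherent G' S" for S
  proof
    assume coh: "coherent G' S"
    have "walk G' S k i = walk G S k i" if "k < nstr G" for k i
    proof (induction i)
      case (Suc i)
      let ?p = "walk G S k i"
      have p: "?p \<in> srcs G \<union> tgts G" by (rule walk_closed[OF wf that])
      have nxt: "nxt G' q = nxt G q" if "q \<in> srcs G" for q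
        using that c by (auto simp: G')
      have "sstep G' S ?p = sstep G S ?p"
      proof (cases ?p)
        case (X d b)
        with p have "sw S ?p \<in> srcs G" by simp
        with X nxt show ?thesis by (simp add: sstep_X)
      next
        case (Bd l)
        with p have "even l \<Longrightarrow> ?p \<in> srcs G" by auto
        with Bd nxt show ?thesis by (cases "even l") (auto simp: sstep_even sstep_odd)
      qed
      with Suc show ?case by (simp add: walk_def)
    qed (simp add: walk_def)
    moreover have "X c True \<in> ends (crs G')" by (simp add: G')
    then obtain k i where "k < nstr G'" "walk G' S k i = X c True"
      using coh unfolding coherent_def visits_def by blast
    then have "k < nstr G" "walk G' S k i = X c True" by (simp_all add: G')
    ultimately have "X c True \<in> srcs G \<union> tgts G" using walk_closed[OF wf, of k S i] by simp
    with c show False by simp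
  qed
  then have "conway G' = 0"
    using fin by (subst conway_eq_sum) (auto simp: G' descending_def)
  with conway_free[OF fin] free show ?thesis by simp
qed

section \<open>First and second moves\<close>

lemma insert_nothing: "(\<And>x. x \<in> set ws \<Longrightarrow> snd x = []) \<Longrightarrow> insert_gd G {} e ws = G"
proof -
  assume e: "\<And>x. x \<in> set ws \<Longrightarrow> snd x = []"
  then have "chain ws a = []" for a by (auto simp: chain_def)
  then have "ins_nxt (nxt G) ws = nxt G" by (auto simp: ins_nxt_def)
  then show ?thesis by (simp add: insert_gd_def)
qed

text \<open>The diagram without the crossings is viewed as the base with \<open>N\<close> empty
  words inserted, which makes the removal of crossings an instance of
  \<open>conway_replace\<close>.\<close>

lemma conway_insert_nothing:
  assumes "slotted G ss N" and locally_equal: "locally_equal N m Ws es 0 (replicate N []) []"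
    and "inj_on g {..<m}" "\<And>c. c < m \<Longrightarrow> e (g c) = es ! c"
    and "ins_ok G (g ` {..<m}) e (map (\<lambda>(a, l). (a, map (mp g) (Ws ! l))) ss)"
  shows "conway (insert_gd G (g ` {..<m}) e (map (\<lambda>(a, l). (a, map (mp g) (Ws ! l))) ss)) = conway G"
proof -
  interpret slotted G ss N by (rule assms(1))
  let ?ws = "map (\<lambda>(a, l). (a, map (mp g) (replicate N [] ! l))) ss"
  \<comment> \<open>The bound ensures that \<open>replicate N []\<close> is indexed within its
    length.\<close>
  have "snd x < N" if "x \<in> set ss" for x using that labels by auto
  then have nil: "snd x = []" if "x \<in> set ?ws" for x using that by auto
  then have cn: "concat (map snd ?ws) = []" by simp
  have "\<forall>x\<in>set ?ws. fst x \<in> srcs G" using anchors by auto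
  then have ok: "ins_ok G (g ` {..<0}) e ?ws"
    unfolding ins_ok_def cn by (intro conjI) (simp_all add: ends_def)
  have "conway (insert_gd G (g ` {..<m}) e (map (\<lambda>(a, l). (a, map (mp g) (Ws ! l))) ss))
      = conway (insert_gd G (g ` {..<0}) e ?ws)"
    using assms ok by (intro conway_replace[where es = es and es' = "[]"]) (auto simp: locally_equal_def)
  also have "insert_gd G (g ` {..<0}) e ?ws = G" using insert_nothing[of ?ws, OF nil] by simp
  finally show ?thesis .
qed

lemma conway_R1:
  assumes wf: "wf_gd G" and "R1 G G'"
  shows "conway G = conway G'"
proof -
  from assms(2) obtain a c ov e where ok: "ins_ok G {c} e [(a, [X c ov, X c (\<not> ov)])]"
    and G': "G' = insert_gd G {c} e [(a, [X c ov, X c (\<not> ov)])]" unfolding R1_def by blast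
  let ?ss = "[(a, 0)]" and ?Ws = "[[X 0 ov, X 0 (\<not> ov)]]" and ?g = "\<lambda>_::nat. c"
  have ws: "map (\<lambda>(a, l). (a, map (mp ?g) (?Ws ! l))) ?ss = [(a, [X c ov, X c (\<not> ov)])]" by simp
  have C: "?g ` {..<1} = {c}" by auto
  have "e c = 1 \<or> e c = -1" using ok by (simp add: ins_ok_def)
  then have ch: "locally_equal 1 1 ?Ws [e c] 0 (replicate 1 []) []"
    using r1_check by (cases ov) auto
  have sl: "slotted G ?ss 1"
    using wf ok by unfold_locales (auto simp: ins_ok_def)
  have inj: "inj_on ?g {..<1}" by (auto simp: inj_on_def)
  have eg: "e (?g n) = [e c] ! n" if "n < 1" for n using that by simp
  have ok': "ins_ok G (?g ` {..<1}) e (map (\<lambda>(a, l). (a, map (mp ?g) (?Ws ! l))) ?ss)"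
    unfolding ws C by (rule ok)
  have "conway (insert_gd G (?g ` {..<1}) e
      (map (\<lambda>(a, l). (a, map (mp ?g) (?Ws ! l))) ?ss)) = conway G"
    by (rule conway_insert_nothing[OF sl ch inj eg ok'])
  then show ?thesis unfolding ws C G' by (rule sym)
qed

lemma conway_R2_insert:
  assumes wf: "wf_gd G" and ne: "c1 \<noteq> c2"
      and ok: "ins_ok G {c1, c2} e ws"
      and s1: "s1 = (a1, [X c1 ov, X c2 ov])"
      and s2: "s2 = (a2, if r then [X c2 (\<not> ov), X c1 (\<not> ov)] else [X c1 (\<not> ov), X c2 (\<not> ov)])"
      and ws: "ws = (if s then [s2, s1] else [s1, s2])"
      and e: "e = (\<lambda>c. if c = c1 then \<epsilon> else - \<epsilon>)"
  shows "conway G = conway (insert_gd G {c1, c2} e ws)"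
proof -
  \<comment> \<open>The order of the pairs matters only if \<open>a1 = a2\<close>, when it decides
    which word comes first on the common edge; the labels stay attached to the words.\<close>
  define ss where "ss = (if s then [(a2, 1), (a1, 0)] else [(a1, 0), (a2, 1::nat)])"
  define g where "g n = (if n = 0 then c1 else c2)" for n :: nat
  let ?Ws = "r2_words ov r"
  have ws': "map (\<lambda>(a, l). (a, map (mp g) (?Ws ! l))) ss = ws"
    by (auto simp: ss_def ws s1 s2 r2_words_def g_def)
  have C: "g ` {..<2} = {c1, c2}" by (auto simp: g_def lessThan_nat_numeral numeral_2_eq_2 lessThan_Suc)
  have "\<epsilon> = 1 \<or> \<epsilon> = -1" using ok by (auto simp: ins_ok_def e)
  then have "locally_equal 2 2 ?Ws [\<epsilon>, - \<epsilon>] 0 [[], []] []"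
    using r2_check by (cases ov; cases r) auto
  then have ch: "locally_equal 2 2 ?Ws [\<epsilon>, - \<epsilon>] 0 (replicate 2 []) []" by (simp add: numeral_2_eq_2)
  have sl: "slotted G ss 2"
    using wf ok by unfold_locales (auto simp: ins_ok_def ss_def ws s1 s2)
  have eg: "e (g c) = [\<epsilon>, - \<epsilon>] ! c" if "c < 2" for c
    using that ne by (auto simp: g_def e less_2_cases_iff)
  have inj: "inj_on g {..<2}" using ne by (auto simp: inj_on_def g_def less_2_cases_iff)
  have ok': "ins_ok G (g ` {..<2}) e (map (\<lambda>(a, l). (a, map (mp g) (?Ws ! l))) ss)"
    unfolding ws' C by (rule ok)
  have "conway (insert_gd G (g ` {..<2}) e
      (map (\<lambda>(a, l). (a, map (mp g) (?Ws ! l))) ss)) = conway G"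
    by (rule conway_insert_nothing[OF sl ch inj eg ok'])
  then show ?thesis unfolding ws' C by (rule sym)
qed

lemma conway_R2:
  assumes "wf_gd G" and "R2 G G'"
  shows "conway G = conway G'"
  by (insert assms(2)[unfolded R2_def Let_def], elim exE conjE, hypsubst)
    (rule conway_R2_insert[OF assms(1) _ _ refl refl refl refl])

section \<open>Third move\<close>

lemma distinct_concat_rev:
  "distinct (concat (map (\<lambda>x. rev (snd x)) ws)) \<longleftrightarrow> distinct (concat (map snd ws))"
  by (induction ws) auto

lemma ins_ok_rev:
  assumes "ins_ok G C e ws"
  shows "ins_ok G C e (map (\<lambda>x. (fst x, rev (snd x))) ws)"
  using assms distinct_concat_rev[of ws] by (auto simp: ins_ok_def o_def)

lemma conway_R3_insert:
  assumes wf: "wf_gd G0" and dist: "distinct [c01, c02, c12]"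
      and r3: "r3_ok b0 b1 b2 e01 e02 e12"
      and len: "length ws = 3" and set: "set ws = {(a0, w0), (a1, w1), (a2, w2)}"
      and ok: "ins_ok G0 C e ws"
      and w0: "w0 = (if b0 then [X c01 True, X c02 True] else [X c02 True, X c01 True])"
      and w1: "w1 = (if b1 then [X c01 False, X c12 True] else [X c12 True, X c01 False])"
      and w2: "w2 = (if b2 then [X c02 False, X c12 False] else [X c12 False, X c02 False])"
      and C: "C = {c01, c02, c12}"
      and e: "e = (\<lambda>c. if c = c01 then e01 else if c = c02 then e02 else e12)"
  shows "conway (insert_gd G0 C e ws)
    = conway (insert_gd G0 C e (map (\<lambda>x. (fst x, rev (snd x))) ws))"
proof -
  define g where "g n = (if n = 0 then c01 else if n = 1 then c02 else c12)" for n :: nat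
  \<comment> \<open>The three words may appear in \<open>ws\<close> in any order. They are pairwise
    different, so each strand's label can be recovered from its word.\<close>
  define lab where "lab w = (if w = w0 then 0 else if w = w1 then 1 else 2::nat)" for w
  define ss where "ss = map (\<lambda>x. (fst x, lab (snd x))) ws"
  let ?Ws = "r3_words b0 b1 b2"
  have lab: "lab w0 = 0" "lab w1 = 1" "lab w2 = 2"
    using dist by (auto simp: lab_def w0 w1 w2)
  have W: "map (mp g) (?Ws ! lab w0) = w0" "map (mp g) (?Ws ! lab w1) = w1"
      "map (mp g) (?Ws ! lab w2) = w2"
    unfolding lab by (auto simp: r3_words_def g_def w0 w1 w2 numeral_2_eq_2)
  then have Wx: "map (mp g) (?Ws ! lab (snd x)) = snd x" if "x \<in> set ws" for x
    using that unfolding set by auto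
  have lab3: "lab w < 3" for w by (simp add: lab_def)
  have lenW: "length ?Ws = 3" by (simp add: r3_words_def)
  have ws: "map (\<lambda>(a, l). (a, map (mp g) (?Ws ! l))) ss = ws"
    unfolding ss_def map_map o_def by (rule map_idI) (simp add: Wx)
  have "map (mp g) (map rev ?Ws ! lab (snd x)) = rev (snd x)" if "x \<in> set ws" for x
    using Wx[OF that] lab3 by (simp add: lenW rev_map[symmetric])
  then have ws': "map (\<lambda>(a, l). (a, map (mp g) (map rev ?Ws ! l))) ss
      = map (\<lambda>x. (fst x, rev (snd x))) ws"
    unfolding ss_def map_map o_def by (intro map_cong refl) simp
  have three: "{..<3} = {0, 1, 2::nat}" by auto
  have gC: "g ` {..<3} = C" unfolding three by (auto simp: g_def C)
  have g: "inj_on g {..<3}" unfolding three using dist by (auto simp: inj_on_def g_def)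
  have eg: "e (g c) = [e01, e02, e12] ! c" if "c < 3" for c
  proof -
    from that consider "c = 0" | "c = 1" | "c = 2" by linarith
    then show ?thesis using dist by cases (auto simp: g_def e)
  qed
  have labels: "set (map snd ss) = {..<3}"
    unfolding three using set lab by (simp add: ss_def)
  \<comment> \<open>Three entries taking three values are distinct, even if anchors
    coincide.\<close>
  have "distinct (map snd ss)"
    by (rule card_distinct, unfold labels) (simp add: ss_def len)
  moreover have "fst ` set ss \<subseteq> srcs G0" using ok by (auto simp: ss_def ins_ok_def)
  ultimately have sl: "slotted G0 ss 3" using wf labels by unfold_locales
  have "e c = 1 \<or> e c = -1" if "c \<in> C" for c using ok that by (simp add: ins_ok_def)
  from this[of c01] this[of c02] this[of c12] dist
  have "e01 = 1 \<or> e01 = -1" "e02 = 1 \<or> e02 = -1" "e12 = 1 \<or> e12 = -1" by (auto simp: C e)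
  then have ch: "locally_equal 3 3 ?Ws [e01, e02, e12] 3 (map rev ?Ws) [e01, e02, e12]"
    using r3_check_all[of b0 b1 b2] r3 by (auto simp: r3_check_def)
  have "conway (insert_gd G0 (g ` {..<3}) e (map (\<lambda>(a, l). (a, map (mp g) (?Ws ! l))) ss))
    = conway (insert_gd G0 (g ` {..<3}) e (map (\<lambda>(a, l). (a, map (mp g) (map rev ?Ws ! l))) ss))"
    by (rule conway_replace[where es = "[e01, e02, e12]" and es' = "[e01, e02, e12]", OF sl])
      (use ch g eg ok ins_ok_rev[OF ok] in \<open>simp_all only: locally_equal_def ws ws' gC\<close>)
  then show ?thesis unfolding ws ws' gC .
qed

lemma conway_R3:
  assumes "R3 G G'"
  shows "conway G = conway G'"
  by (insert assms[unfolded R3_def Let_def], elim exE conjE, hypsubst)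
    (rule conway_R3_insert[OF _ _ _ _ _ _ refl refl refl refl refl])

theorem mainTheorem2:
  assumes "wf_gd D" and "wf_gd D'" and "tangle_equiv D D'"
  shows "conway D = conway D'"
proof -
  have move: "conway G = conway G'" if "wf_gd G \<and> wf_gd G' \<and> move G G'" for G G'
    using that conway_iso conway_R1 conway_R1free conway_R2 conway_R3 unfolding move_def by blast
  from assms(3) show ?thesis
    unfolding tangle_equiv_def
  proof (induction rule: equivclp_induct)
    case (step G G')
    with move show ?case by metis
  qed simp
qed

end
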